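(* Let $n \ge 1$ be an integer. For $u \in W^{1,1}(\mathbf{R}^{n+1}_+)$, $u \ne 0$, let $$J(u) = \frac{\int_{\mathbf{R}^{n+1}_+} |\nabla u(x,y)|\,dx\,dy}{\int_{\mathbf{R}^n} |u(x,0)|\,dx}, \qquad \mathbf{I} = \inf\{ J(u) : u \in W^{1,1}(\mathbf{R}^{n+1}_+),\ u \neq 0 \}.$$ Then no extremal function exists: there is no $u \in W^{1,1}(\mathbf{R}^{n+1}_+)$, $u \neq 0$, with $J(u) = \mathbf{I}$.
   Context: $\mathbf{R}^{n+1}_+ = \{(x,y) : x \in \mathbf{R}^n,\ y > 0\}$; $W^{1,1}(\mathbf{R}^{n+1}_+)$ is the Sobolev space of functions in $L^1(\mathbf{R}^{n+1}_+)$ with weak gradient in $L^1(\mathbf{R}^{n+1}_+)$; $u(x,0)$ denotes the trace of $u$ on $\mathbf{R}^n$. If $u\neq 0$ has zero trace, $J(u)$ is understood as $+\infty$. *)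

theory Defs
  imports "HOL-Analysis.Analysis"
begin

text \<open>
  A point of \<open>\<real>\<^sup>n\<^sup>+\<^sup>1\<close> is a pair \<open>(x, y) :: (real^'n) \<times> real\<close> with \<open>n = CARD('n) \<ge> 1\<close>; the product norm is
  the Euclidean norm.  Elements of \<open>L\<^sup>1\<close> are given by Borel measurable representatives.
\<close>

definition half_space :: "((real^'n) \<times> real) set" where
  "half_space = {(x, y). y > 0}"

definition closed_half_space :: "((real^'n) \<times> real) set" where
  "closed_half_space = {(x, y). y \<ge> 0}"

primrec C_times :: "nat \<Rightarrow> ('a::euclidean_space \<Rightarrow> real) \<Rightarrow> bool" where
  "C_times 0 f \<longleftrightarrow> continuous_on UNIV f"
| "C_times (Suc k) f \<longleftrightarrow>
     (\<forall>x. f differentiable (at x)) \<and> (\<forall>v. C_times k (\<lambda>x. frechet_derivative f (at x) v))"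

definition test_function :: "'a::euclidean_space set \<Rightarrow> ('a \<Rightarrow> real) \<Rightarrow> bool" where
  "test_function S \<phi> \<longleftrightarrow>
     (\<forall>k. C_times k \<phi>) \<and> compact (closure {z. \<phi> z \<noteq> 0}) \<and> closure {z. \<phi> z \<noteq> 0} \<subseteq> S"

definition L1_weak_gradient ::
    "((real^'n) \<times> real \<Rightarrow> real) \<Rightarrow> ((real^'n) \<times> real \<Rightarrow> (real^'n) \<times> real) \<Rightarrow> bool" where
  "L1_weak_gradient u g \<longleftrightarrow>
     set_integrable lborel half_space g \<and>
     (\<forall>\<phi>. test_function half_space \<phi> \<longrightarrow>
       (\<forall>e\<in>Basis. (LINT z:half_space|lborel. u z * frechet_derivative \<phi> (at z) e)
                  = - (LINT z:half_space|lborel. (g z \<bullet> e) * \<phi> z)))"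

definition W11 :: "((real^'n) \<times> real \<Rightarrow> real) set" where
  "W11 = {u. set_integrable lborel half_space u \<and> (\<exists>g. L1_weak_gradient u g)}"

text \<open>Unique up to null sets in the half-space.\<close>
definition weak_grad :: "((real^'n) \<times> real \<Rightarrow> real) \<Rightarrow> (real^'n) \<times> real \<Rightarrow> (real^'n) \<times> real" where
  "weak_grad u = (SOME g. L1_weak_gradient u g)"

definition W11_nonzero :: "((real^'n) \<times> real \<Rightarrow> real) set" where
  "W11_nonzero = {u \<in> W11. \<not> (AE z in lborel. z \<in> half_space \<longrightarrow> u z = 0)}"

text \<open>
  The trace operator is the continuous extension to \<open>W\<^sup>1\<^sup>,\<^sup>1\<close>, with values in \<open>L\<^sup>1(\<real>\<^sup>n)\<close>, of the
  restriction \<open>u \<mapsto> u(\<cdot>, 0)\<close> on functions in \<open>W\<^sup>1\<^sup>,\<^sup>1\<close> that are continuous up to the boundary.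
\<close>
definition has_trace :: "((real^'n) \<times> real \<Rightarrow> real) \<Rightarrow> (real^'n \<Rightarrow> real) \<Rightarrow> bool" where
  "has_trace u f \<longleftrightarrow>
     integrable lborel f \<and>
     (\<exists>U :: nat \<Rightarrow> (real^'n) \<times> real \<Rightarrow> real.
        (\<forall>k. U k \<in> W11 \<and> continuous_on closed_half_space (U k)) \<and>
        (\<lambda>k. LINT z:half_space|lborel. \<bar>U k z - u z\<bar>) \<longlonglongrightarrow> 0 \<and>
        (\<lambda>k. LINT z:half_space|lborel. norm (weak_grad (U k) z - weak_grad u z)) \<longlonglongrightarrow> 0 \<and>
        (\<lambda>k. \<integral>\<^sup>+x. ennreal \<bar>U k (x, 0) - f x\<bar> \<partial>lborel) \<longlonglongrightarrow> 0)"

text \<open>Unique up to null sets.\<close>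
definition boundary_trace :: "((real^'n) \<times> real \<Rightarrow> real) \<Rightarrow> real^'n \<Rightarrow> real" where
  "boundary_trace u = (SOME f. has_trace u f)"

definition J :: "((real^'n) \<times> real \<Rightarrow> real) \<Rightarrow> ereal" where
  "J u = (if AE x in lborel. boundary_trace u x = 0 then \<infinity>
          else ereal ((LINT z:half_space|lborel. norm (weak_grad u z))
                      / (LINT x|lborel. \<bar>boundary_trace u x\<bar>)))"

end

theory Submission
  imports Defs
begin

text \<open>
  Integrating \<open>\<partial>u/\<partial>y\<close> along vertical lines gives \<open>\<integral>|u(x, 0)| dx \<le> \<integral>|\<partial>u/\<partial>y| \<le> \<integral>|\<nabla>u|\<close>, so \<open>J \<ge> 1\<close>, while
  \<open>\<psi>(x) exp(-y/\<epsilon>)\<close> with a fixed bump \<open>\<psi>\<close> shows that the infimum is 1 as \<open>\<epsilon> \<rightarrow> 0\<close>.  An extremal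
  function would have \<open>|\<nabla>u| = |\<partial>u/\<partial>y|\<close> almost everywhere, hence vanishing horizontal gradient.
  It would be invariant under horizontal translations, and an integrable function with this
  property is zero.

  All averaging is over translates directed into the half-space, so no extension of \<open>u\<close> across the
  boundary is needed, and averages over boxes are already continuous, so the approximation that
  defines the trace needs no smooth mollifier.
\<close>

section \<open>Smooth bumps and test functions\<close>

text \<open>Both \<open>weak_grad\<close> and \<open>boundary_trace\<close> are picked by
  \<open>SOME\<close>, and a trace is only a limit. The work is therefore done with arbitrary
  representatives, and almost everywhere uniqueness carries the results back to the chosen ones. A
  weak gradient is known only through test functions, so integration along lines is obtained by
  duality: the line integral is moved onto the test function, where the classical fundamental
  theorem of calculus applies. The right-hand side of the trace inequality must keep
  \<partial>u/\<partial>y alone. The bound by |\<nabla>u| would give the same infimum, but the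
  extremal argument uses the gap between the two. An integrable function need not tend to 0 along
  each line. What replaces decay is that shifting it by \<open>k\<close> in a fixed direction
  removes, as \<open>k\<close> grows, its mass from every set that this direction leaves. This is
  used once vertically, for the trace inequality, and once horizontally, for the extremal
  function.\<close>

definition flat :: "nat \<Rightarrow> real \<Rightarrow> real" where
  "flat m t = (if t > 0 then inverse t ^ m * exp (- inverse t) else 0)"

lemma flat_nonpos [simp]: "t \<le> 0 \<Longrightarrow> flat m t = 0"
  by (simp add: flat_def)

lemma flat_0_pos: "t > 0 \<Longrightarrow> flat 0 t > 0"
  by (simp add: flat_def)

lemma flat_0_bounds: "0 \<le> flat 0 t" "flat 0 t \<le> 1"
  by (auto simp: flat_def)

lemma flat_tendsto_0: "(flat m \<longlongrightarrow> 0) (at 0)"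
proof -
  have "((\<lambda>t. inverse t ^ m * exp (- inverse t)) \<longlongrightarrow> 0) (at_right (0::real))"
    using filterlim_compose[OF tendsto_power_div_exp_0 filterlim_inverse_at_top_right]
    by (simp add: exp_minus divide_inverse)
  then have "(flat m \<longlongrightarrow> 0) (at_right 0)"
    by (rule Lim_transform_eventually) (auto simp: flat_def eventually_at_filter)
  moreover have "(flat m \<longlongrightarrow> 0) (at_left 0)"
    by (rule Lim_transform_eventually[OF tendsto_const]) (auto simp: eventually_at_filter)
  ultimately show ?thesis
    by (simp add: filterlim_split_at)
qed

text \<open>Differentiating exp(-1/t) produces powers of 1/t, so the exponent is carried as a
  parameter and the family becomes closed under differentiation up to linear combinations. At 0 the
  difference quotient of \<open>flat m\<close> is \<open>flat (Suc m)\<close>, which tends to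
  0.\<close>

lemma flat_has_real_derivative:
  "(flat m has_real_derivative (flat (m + 2) t - of_nat m * flat (m + 1) t)) (at t)"
proof -
  consider "t > 0" | "t < 0" | "t = 0" by linarith
  then show ?thesis
  proof cases
    case 1
    have [derivative_intros]: "(inverse has_real_derivative - (inverse t)\<^sup>2) (at t)"
      using 1 DERIV_inverse[of t UNIV] by (simp add: numeral_2_eq_2)
    have "real m * inverse t ^ (m - Suc 0) * (inverse t)\<^sup>2 = real m * inverse t ^ (m + 1)"
      by (cases m) (simp_all add: power2_eq_square)
    then have "((\<lambda>t. inverse t ^ m * exp (- inverse t)) has_real_derivative
            (flat (m + 2) t - of_nat m * flat (m + 1) t)) (at t)"
      using 1 by (auto intro!: derivative_eq_intros simp: flat_def power2_eq_square algebra_simps)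
    then show ?thesis
      by (rule has_field_derivative_transform_within_open[where S = "{0<..}"]) (use 1 in \<open>auto simp: flat_def\<close>)
  next
    case 2
    have "((\<lambda>t. 0) has_real_derivative 0) (at t)" by simp
    then have "(flat m has_real_derivative 0) (at t)"
      by (rule has_field_derivative_transform_within_open[where S = "{..<0}"]) (use 2 in auto)
    with 2 show ?thesis by simp
  next
    case 3
    have "flat (Suc m) = (\<lambda>t. flat m t / t)"
      by (auto simp: flat_def field_simps fun_eq_iff)
    then have "((\<lambda>t. flat m t / t) \<longlongrightarrow> 0) (at 0)"
      using flat_tendsto_0[of "Suc m"] by simp
    then show ?thesis
      using 3 by (simp add: has_field_derivative_iff)
  qed
qed

text \<open>A class closed under all directional derivatives: \<open>C_times k\<close> then follows
  by induction on \<open>k\<close>, with no higher derivative computed. Ridge functions and products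
  are what the box-shaped bumps are built from.\<close>

inductive flat_generated :: "('a::euclidean_space \<Rightarrow> real) \<Rightarrow> bool" where
  const: "flat_generated (\<lambda>_. c)"
| flat: "flat_generated (\<lambda>z. flat m (z \<bullet> a + c))"
| add: "flat_generated f \<Longrightarrow> flat_generated g \<Longrightarrow> flat_generated (\<lambda>z. f z + g z)"
| mult: "flat_generated f \<Longrightarrow> flat_generated g \<Longrightarrow> flat_generated (\<lambda>z. f z * g z)"

lemma flat_generated_derivative:
  "flat_generated f \<Longrightarrow>
    \<exists>f'. (\<forall>z. (f has_derivative f' z) (at z)) \<and> (\<forall>v. flat_generated (\<lambda>z. f' z v))"
proof (induction rule: flat_generated.induct)
  case (const c)
  then show ?case
    by (intro exI[of _ "\<lambda>_ _. 0"]) (auto intro: flat_generated.const)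
next
  case (flat m a c)
  let ?f' = "\<lambda>z v. (flat (m + 2) (z \<bullet> a + c) + (- of_nat m) * flat (m + 1) (z \<bullet> a + c)) * (v \<bullet> a)"
  have "((\<lambda>z. flat m (z \<bullet> a + c)) has_derivative ?f' z) (at z)" for z
  proof -
    have "((\<lambda>z. z \<bullet> a + c) has_derivative (\<lambda>v. v \<bullet> a)) (at z)"
      by (auto intro!: derivative_eq_intros)
    from has_derivative_compose[OF this flat_has_real_derivative[unfolded has_field_derivative_def, of m "z \<bullet> a + c"]]
    show ?thesis by simp
  qed
  then show ?case
    by (intro exI[of _ ?f'] conjI allI flat_generated.intros)
next
  case (add f g)
  then obtain f' g' where *: "\<And>z. (f has_derivative f' z) (at z)" "\<And>v. flat_generated (\<lambda>z. f' z v)"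
    "\<And>z. (g has_derivative g' z) (at z)" "\<And>v. flat_generated (\<lambda>z. g' z v)" by metis
  then show ?case
    by (intro exI[of _ "\<lambda>z v. f' z v + g' z v"]) (auto intro!: flat_generated.intros has_derivative_add)
next
  case (mult f g)
  then obtain f' g' where *: "\<And>z. (f has_derivative f' z) (at z)" "\<And>v. flat_generated (\<lambda>z. f' z v)"
    "\<And>z. (g has_derivative g' z) (at z)" "\<And>v. flat_generated (\<lambda>z. g' z v)" by metis
  with mult.hyps show ?case
    by (intro exI[of _ "\<lambda>z v. f z * g' z v + f' z v * g z"]) (auto intro!: flat_generated.intros has_derivative_mult)
qed

lemma C_times_flat_generated: "flat_generated f \<Longrightarrow> C_times k f"
proof (induction k arbitrary: f)
  case 0
  then show ?case
    using flat_generated_derivative has_derivative_continuous continuous_at_imp_continuous_on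
    by (metis C_times.simps(1))
next
  case (Suc k)
  obtain f' where f': "\<And>z. (f has_derivative f' z) (at z)" "\<And>v. flat_generated (\<lambda>z. f' z v)"
    using flat_generated_derivative[OF Suc.prems] by auto
  then have "frechet_derivative f (at z) = f' z" for z
    using frechet_derivative_at by metis
  with f' Suc.IH show ?case
    by (auto simp: differentiable_def)
qed

lemma flat_generated_prod:
  "finite I \<Longrightarrow> (\<And>i. i \<in> I \<Longrightarrow> flat_generated (f i)) \<Longrightarrow> flat_generated (\<lambda>z. \<Prod>i\<in>I. f i z)"
  by (induction I rule: finite_induct) (auto intro: flat_generated.intros)

text \<open>As \<open>k\<close> grows, these smooth functions increase to the indicator function of the open box.\<close>
definition box_bump :: "'a::euclidean_space \<Rightarrow> 'a \<Rightarrow> nat \<Rightarrow> 'a \<Rightarrow> real" where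
  "box_bump a b k z = (\<Prod>i\<in>Basis. flat 0 (real k * (z \<bullet> i - a \<bullet> i)) * flat 0 (real k * (b \<bullet> i - z \<bullet> i)))"

lemma box_bump_bounds: "0 \<le> box_bump a b k z" "box_bump a b k z \<le> 1"
  unfolding box_bump_def
  by (auto intro!: prod_nonneg prod_le_1 mult_nonneg_nonneg mult_le_one flat_0_bounds)

lemma box_bump_outside: "z \<notin> box a b \<Longrightarrow> box_bump a b k z = 0"
  unfolding box_bump_def
  by (auto simp: mem_box not_less mult_nonneg_nonpos intro!: prod_zero bexI)

lemma box_bump_pos: "z \<in> box a b \<Longrightarrow> k > 0 \<Longrightarrow> box_bump a b k z > 0"
  unfolding box_bump_def by (auto simp: mem_box intro!: prod_pos mult_pos_pos flat_0_pos)

lemma tendsto_flat_0: "t > 0 \<Longrightarrow> (\<lambda>k. flat 0 (real k * t)) \<longlonglongrightarrow> 1"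
proof -
  assume t: "t > 0"
  have "(\<lambda>k. exp (- (inverse (real k) * inverse t))) \<longlonglongrightarrow> exp (- (0 * inverse t))"
    by (intro tendsto_intros lim_inverse_n)
  then have "(\<lambda>k. exp (- (inverse (real k) * inverse t))) \<longlonglongrightarrow> 1" by simp
  then show ?thesis
    by (rule Lim_transform_eventually)
       (use t in \<open>auto simp: flat_def zero_less_mult_iff intro!: eventually_mono[OF eventually_gt_at_top[of 0]]\<close>)
qed

lemma tendsto_box_bump: "(\<lambda>k. box_bump a b k z) \<longlonglongrightarrow> indicator (box a b) z"
proof (cases "z \<in> box a b")
  case True
  then have "(\<lambda>k. box_bump a b k z) \<longlonglongrightarrow> (\<Prod>i\<in>(Basis::'a set). 1 * 1)"
    unfolding box_bump_def by (intro tendsto_prod tendsto_mult tendsto_flat_0) (auto simp: mem_box)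
  with True show ?thesis by simp
qed (simp add: box_bump_outside)

lemma test_function_box_bump:
  assumes "cbox a b \<subseteq> S" shows "test_function S (box_bump a b k)"
proof -
  have "flat_generated (\<lambda>z. flat 0 (z \<bullet> (real k *\<^sub>R i) + (- real k * (a \<bullet> i))) *
      flat 0 (z \<bullet> (- real k *\<^sub>R i) + real k * (b \<bullet> i)))" for i :: 'a
    by (intro flat_generated.mult flat_generated.flat)
  then have "flat_generated (\<lambda>z. \<Prod>i\<in>Basis. flat 0 (z \<bullet> (real k *\<^sub>R i) + (- real k * (a \<bullet> i))) *
      flat 0 (z \<bullet> (- real k *\<^sub>R i) + real k * (b \<bullet> i)))"
    by (intro flat_generated_prod) auto
  then have "flat_generated (box_bump a b k)"
    by (rule back_subst[of flat_generated]) (auto simp: box_bump_def fun_eq_iff algebra_simps)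
  moreover have "closure {z. box_bump a b k z \<noteq> 0} \<subseteq> cbox a b"
    using box_bump_outside[of _ a b k] box_subset_cbox[of a b] by (intro closure_minimal) auto
  moreover from this have "compact (closure {z. box_bump a b k z \<noteq> 0})"
    by (metis closed_closure compact_cbox compact_Int_closed inf.absorb_iff2)
  ultimately show ?thesis
    using assms by (auto simp: test_function_def C_times_flat_generated)
qed

section \<open>Translation, support and boundedness of test functions\<close>

lemma C_times_translate:
  "C_times k f \<Longrightarrow> C_times k (\<lambda>z. f (z - c))"
proof (induction k arbitrary: f)
  case 0
  then show ?case by (auto intro!: continuous_on_compose2[of UNIV f] continuous_intros)
next
  case (Suc k)
  have "((\<lambda>z. f (z - c)) has_derivative frechet_derivative f (at (z - c))) (at z)" for z
  proof -
    have "(f has_derivative frechet_derivative f (at (z - c))) (at (z - c))"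
      using Suc.prems frechet_derivative_works by auto
    then show ?thesis
      by (rule has_derivative_compose[of "\<lambda>z. z - c" "\<lambda>v. v" z UNIV f, rotated]) (auto intro!: derivative_eq_intros)
  qed
  then have "frechet_derivative (\<lambda>z. f (z - c)) (at z) = frechet_derivative f (at (z - c))"
    "(\<lambda>z. f (z - c)) differentiable (at z)" for z
    using frechet_derivative_at by (metis, auto simp: differentiable_def)
  moreover have "C_times k (\<lambda>z. frechet_derivative f (at (z - c)) v)" for v
    by (rule Suc.IH[of "\<lambda>z. frechet_derivative f (at z) v"]) (use Suc.prems in auto)
  ultimately show ?case by auto
qed

lemma test_function_has_derivative:
  "test_function S \<phi> \<Longrightarrow> (\<phi> has_derivative frechet_derivative \<phi> (at z)) (at z)"
  by (metis C_times.simps(2) frechet_derivative_works test_function_def)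

lemma frechet_derivative_translate:
  assumes "test_function S \<phi>"
  shows "frechet_derivative (\<lambda>z. \<phi> (z - c)) (at z) = frechet_derivative \<phi> (at (z - c))"
proof -
  have "((\<lambda>z. \<phi> (z - c)) has_derivative frechet_derivative \<phi> (at (z - c))) (at z)"
    by (rule has_derivative_compose[of "\<lambda>z. z - c" "\<lambda>v. v" z UNIV \<phi>, OF _ test_function_has_derivative[OF assms]])
       (auto intro!: derivative_eq_intros)
  then show ?thesis using frechet_derivative_at by metis
qed

lemma test_function_continuous: "test_function S \<phi> \<Longrightarrow> continuous_on UNIV \<phi>"
  by (metis C_times.simps(1) test_function_def)

lemma test_function_derivative_continuous:
  "test_function S \<phi> \<Longrightarrow> continuous_on UNIV (\<lambda>z. frechet_derivative \<phi> (at z) v)"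
  by (metis C_times.simps test_function_def)

lemma test_function_outside: "test_function S \<phi> \<Longrightarrow> z \<notin> S \<Longrightarrow> \<phi> z = 0"
  unfolding test_function_def by (metis (mono_tags) closure_subset mem_Collect_eq subsetD)

lemma frechet_derivative_zero_outside:
  assumes "z \<notin> closure {z. \<phi> z \<noteq> 0}"
  shows "frechet_derivative \<phi> (at z) v = 0"
proof -
  have "((\<lambda>_. 0) has_derivative (\<lambda>_. 0)) (at z)" by simp
  then have "(\<phi> has_derivative (\<lambda>_. 0)) (at z)"
    by (rule has_derivative_transform_within_open[where s = "- closure {z. \<phi> z \<noteq> 0}"])
       (use assms closure_subset[of "{z. \<phi> z \<noteq> 0}"] in auto)
  then show ?thesis by (metis frechet_derivative_at)
qed

lemma test_function_derivative_outside:
  "test_function S \<phi> \<Longrightarrow> z \<notin> S \<Longrightarrow> frechet_derivative \<phi> (at z) v = 0"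
  by (rule frechet_derivative_zero_outside) (auto simp: test_function_def)

lemma continuous_compact_support_bounded:
  fixes f :: "'a::euclidean_space \<Rightarrow> real"
  assumes "continuous_on UNIV f" "compact K" "\<And>z. z \<notin> K \<Longrightarrow> f z = 0"
  obtains B where "B \<ge> 0" "\<And>z. \<bar>f z\<bar> \<le> B"
proof -
  have "compact (f ` K)"
    using assms continuous_on_subset[of UNIV f K] by (intro compact_continuous_image) auto
  then obtain B where "\<And>x. x \<in> f ` K \<Longrightarrow> norm x \<le> B"
    using compact_imp_bounded bounded_iff by metis
  \<comment> \<open>If \<open>K\<close> is empty, \<open>B\<close> may be negative while
    \<open>f\<close> vanishes identically; the maximum with 0 covers this.\<close>
  then have "\<bar>f z\<bar> \<le> max B 0" for z
    using assms(3)[of z] by (cases "z \<in> K") (auto simp: le_max_iff_disj)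
  then show ?thesis using that[of "max B 0"] by auto
qed

lemma test_function_bounded:
  assumes "test_function S \<phi>" obtains B where "B \<ge> 0" "\<And>z. \<bar>\<phi> z\<bar> \<le> B"
  using assms continuous_compact_support_bounded[of \<phi> "closure {z. \<phi> z \<noteq> 0}"]
    test_function_continuous[OF assms] subsetD[OF closure_subset, of _ "{z. \<phi> z \<noteq> 0}"]
  unfolding test_function_def by blast

lemma test_function_derivative_bounded:
  assumes "test_function S \<phi>" obtains B where "B \<ge> 0" "\<And>z. \<bar>frechet_derivative \<phi> (at z) v\<bar> \<le> B"
  using assms continuous_compact_support_bounded[of "\<lambda>z. frechet_derivative \<phi> (at z) v" "closure {z. \<phi> z \<noteq> 0}"]
    test_function_derivative_continuous[OF assms] frechet_derivative_zero_outside[of _ \<phi> v]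
  unfolding test_function_def by blast

text \<open>The substitution that turns \<open>u (z + c)\<close> against \<open>\<phi> z\<close>
  into \<open>u z\<close> against \<open>\<phi> (z - c)\<close> moves the support by
  \<open>c\<close>. For \<open>half_space\<close> the support stays inside as soon as
  \<open>snd c \<ge> 0\<close>, which is why \<open>u\<close> is averaged over upward shifts
  only.\<close>

lemma test_function_translate:
  assumes "test_function S \<phi>" "\<And>z. z \<in> S \<Longrightarrow> z + c \<in> S"
  shows "test_function S (\<lambda>z. \<phi> (z - c))"
proof -
  have "{z. \<phi> (z - c) \<noteq> 0} = (+) c ` {z. \<phi> z \<noteq> 0}"
    by (auto simp: image_iff) (metis add_diff_cancel_left' diff_add_cancel add.commute)
  then have "closure {z. \<phi> (z - c) \<noteq> 0} = (+) c ` closure {z. \<phi> z \<noteq> 0}"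
    by (simp add: closure_translation)
  then show ?thesis
    using assms compact_translation[of "closure {z. \<phi> z \<noteq> 0}" c] unfolding test_function_def
    by (auto simp: C_times_translate add.commute image_subset_iff subset_iff)
qed

section \<open>The fundamental lemma of the calculus of variations\<close>

text \<open>Dynkin's argument: open boxes form an intersection-stable generator of the Borel sets,
  and sets with vanishing integral are closed under complements and countable disjoint unions. A
  density whose integral over every Borel set is 0 vanishes almost everywhere.\<close>

lemma integral_boxes_zero_imp_AE_zero:
  fixes f :: "'a::euclidean_space \<Rightarrow> real"
  assumes f: "integrable lborel f" and boxes: "\<And>a b. (LINT z:box a b|lborel. f z) = 0"
  shows "AE z in lborel. f z = 0"
proof -
  note [measurable] = borel_measurable_integrable[OF f]
  have si: "set_integrable lborel A f" if "A \<in> sets borel" for A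
    using that f unfolding set_integrable_def by (intro integrable_mult_indicator) auto
  let ?G = "range (\<lambda>(a, b). box a b :: 'a set)"
  have sets_borel: "sets borel = sigma_sets UNIV ?G"
    by (subst borel_eq_box) simp
  \<comment> \<open>The integral over the whole space, an increasing union of boxes, must vanish for
    the complement step below.\<close>
  have "(\<lambda>n. LINT z:box (- real n *\<^sub>R One) (real n *\<^sub>R One)|lborel. f z) \<longlonglongrightarrow>
      (LINT z:(\<Union>n. box (- real n *\<^sub>R One) (real n *\<^sub>R One))|lborel. f z)"
    by (rule set_integral_cont_up) (auto intro!: si simp: incseq_def box_def set_eq_iff inner_simps)
  then have UNIV0: "(LINT z:UNIV|lborel. f z) = 0"
    by (simp add: boxes UN_box_eq_UNIV LIMSEQ_const_iff)
  have "(LINT z:A|lborel. f z) = 0" if "A \<in> sets borel" for A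
  proof -
    have "Int_stable ?G"
      by (auto simp: Int_stable_def box_Int_box)
    moreover have "?G \<subseteq> Pow UNIV" by simp
    moreover have "A \<in> sigma_sets UNIV ?G" using that sets_borel by simp
    ultimately show ?thesis
    proof (induction rule: sigma_sets_induct_disjoint)
      case (basic A)
      with boxes show ?case by auto
    next
      case empty
      show ?case by (simp add: set_lebesgue_integral_def)
    next
      case (compl A)
      then have A: "A \<in> sets borel" using sets_borel by simp
      have "(LINT z:A \<union> (UNIV - A)|lborel. f z) = (LINT z:A|lborel. f z) + (LINT z:UNIV - A|lborel. f z)"
        using A by (intro set_integral_Un si) auto
      moreover have "A \<union> (UNIV - A) = UNIV" by blast
      ultimately show ?case using UNIV0 compl(2) by (simp del: Un_Diff_cancel)
    next
      case (union A)
      have A: "A i \<in> sets borel" for i using union(2) sets_borel by blast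
      have "(LINT z:(\<Union>i. A i)|lborel. f z) = (\<Sum>i. LINT z:A i|lborel. f z)"
      proof (rule lebesgue_integral_countable_add)
        show "set_integrable lborel (\<Union>i. A i) f" by (intro si sets.countable_UN) (use A in auto)
        show "A i \<inter> A j = {}" if "i \<noteq> j" for i j using union(1) that by (auto simp: disjoint_family_on_def)
      qed (use A in auto)
      with union(3) show ?case by simp
    qed
  qed
  then show ?thesis
    using density_unique_real[OF f integrable_zero] by (auto simp: set_lebesgue_integral_def)
qed

text \<open>Smooth bumps converge to the indicator of an open box, so dominated convergence
  transfers the vanishing integrals to boxes whose closure lies in \<open>S\<close>; countably many
  closed boxes cover \<open>S\<close>.\<close>

lemma test_function_integrals_zero_imp_AE_zero:
  fixes f :: "'a::euclidean_space \<Rightarrow> real"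
  assumes f: "set_integrable lborel S f" and "open S"
    and zero: "\<And>\<phi>. test_function S \<phi> \<Longrightarrow> (LINT z:S|lborel. f z * \<phi> z) = 0"
  shows "AE z in lborel. z \<in> S \<longrightarrow> f z = 0"
proof -
  have AE_box: "AE z in lborel. z \<in> box a b \<longrightarrow> f z = 0" if cb: "cbox a b \<subseteq> S" for a b
  proof -
    have bS: "box a b \<subseteq> S" using cb box_subset_cbox by blast
    have fb: "set_integrable lborel (box a b) f"
      using set_integrable_subset[OF f] bS by auto
    have sub0: "(LINT z:box c d|lborel. f z) = 0" if sub: "cbox c d \<subseteq> S" for c d
    proof -
      have "(\<lambda>k. LINT z:S|lborel. f z * box_bump c d k z) \<longlonglongrightarrow> (LINT z:box c d|lborel. f z)"
        unfolding set_lebesgue_integral_def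
      proof (rule integral_dominated_convergence[where w = "\<lambda>z. norm (indicator S z *\<^sub>R f z)"])
        note [measurable] = f[unfolded set_integrable_def, THEN borel_measurable_integrable]
        show "integrable lborel (\<lambda>z. norm (indicator S z *\<^sub>R f z))"
          using f by (simp add: set_integrable_def)
        have [measurable]: "box_bump c d k \<in> borel_measurable borel" for k
          using test_function_continuous[OF test_function_box_bump[OF sub]]
          by (rule borel_measurable_continuous_onI)
        have "(\<lambda>z. indicator (box c d) z *\<^sub>R (indicator S z *\<^sub>R f z)) \<in> borel_measurable lborel" by measurable
        then show "(\<lambda>z. indicator (box c d) z *\<^sub>R f z) \<in> borel_measurable lborel"
          by (rule measurable_cong[THEN iffD1, rotated])
             (use sub box_subset_cbox[of c d] in \<open>auto simp: indicator_def\<close>)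
        have "(\<lambda>z. (indicator S z *\<^sub>R f z) * box_bump c d k z) \<in> borel_measurable lborel" for k by measurable
        then show "(\<lambda>z. indicator S z *\<^sub>R (f z * box_bump c d k z)) \<in> borel_measurable lborel" for k
          by (simp add: mult.assoc)
        show "AE z in lborel. (\<lambda>k. indicator S z *\<^sub>R (f z * box_bump c d k z)) \<longlonglongrightarrow> indicator (box c d) z *\<^sub>R f z"
        proof (rule AE_I2)
          fix z
          have "(\<lambda>k. indicator S z *\<^sub>R (f z * box_bump c d k z)) \<longlonglongrightarrow> indicator S z *\<^sub>R (f z * indicator (box c d) z)"
            by (intro tendsto_intros tendsto_box_bump)
          also have "indicator S z *\<^sub>R (f z * indicator (box c d) z) = indicator (box c d) z *\<^sub>R f z"
            using sub box_subset_cbox[of c d] by (auto simp: indicator_def)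
          finally show "(\<lambda>k. indicator S z *\<^sub>R (f z * box_bump c d k z)) \<longlonglongrightarrow> indicator (box c d) z *\<^sub>R f z" .
        qed
        show "AE z in lborel. norm (indicator S z *\<^sub>R (f z * box_bump c d k z)) \<le> norm (indicator S z *\<^sub>R f z)" for k
          using box_bump_bounds[of c d k] by (auto simp: indicator_def abs_mult intro!: mult_left_le)
      qed
      moreover have "(LINT z:S|lborel. f z * box_bump c d k z) = 0" for k
        by (rule zero[OF test_function_box_bump[OF sub]])
      ultimately show ?thesis by (simp add: LIMSEQ_const_iff)
    qed
    \<comment> \<open>Cutting \<open>f\<close> off to a fixed box gives a function integrable on the
      whole space, and testing it on another box is testing \<open>f\<close> on the intersection,
      again a box.\<close>
    have "AE z in lborel. indicator (box a b) z *\<^sub>R f z = 0"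
    proof (rule integral_boxes_zero_imp_AE_zero)
      show "integrable lborel (\<lambda>z. indicator (box a b) z *\<^sub>R f z)"
        using fb by (simp add: set_integrable_def)
      fix c d
      obtain p q where pq: "box c d \<inter> box a b = box p q"
        using box_Int_box by blast
      have "(LINT z:box c d|lborel. indicator (box a b) z *\<^sub>R f z) = (LINT z:box p q|lborel. f z)"
        unfolding set_lebesgue_integral_def pq[symmetric]
        by (rule Bochner_Integration.integral_cong) (auto simp: indicator_def)
      also have "\<dots> = 0"
      \<comment> \<open>An empty \<open>box p q\<close> may have a nonempty, degenerate
        \<open>cbox p q\<close>, so only the nonempty case can be passed to closures.\<close>
      proof (cases "box p q = {}")
        case False
        have "box p q \<subseteq> cbox a b" using pq box_subset_cbox[of a b] by blast
        then have "cbox p q \<subseteq> cbox a b"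
          using False closure_box[of p q] closure_minimal[of "box p q" "cbox a b"] by auto
        then show ?thesis using cb by (intro sub0) auto
      qed (simp add: set_lebesgue_integral_def)
      finally show "(LINT z:box c d|lborel. indicator (box a b) z *\<^sub>R f z) = 0" .
    qed
    then show ?thesis by eventually_elim (auto simp: indicator_def)
  qed
  obtain D where D: "countable D" "D \<subseteq> Pow S" "\<And>X. X \<in> D \<Longrightarrow> \<exists>a b. X = cbox a b" "\<Union>D = S"
    using open_countable_Union_open_cbox[OF \<open>open S\<close>] by metis
  have "AE z in lborel. z \<in> X \<longrightarrow> f z = 0" if "X \<in> D" for X
  proof -
    obtain a b where X: "X = cbox a b" using D(3)[OF \<open>X \<in> D\<close>] by blast
    have "cbox a b - box a b \<in> null_sets lborel"
      by (rule null_sets_cbox_Diff_box)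
    then have "AE z in lborel. z \<notin> cbox a b - box a b" by (rule AE_not_in)
    moreover have "AE z in lborel. z \<in> box a b \<longrightarrow> f z = 0"
      by (rule AE_box) (use \<open>X \<in> D\<close> D(2) X in blast)
    ultimately show ?thesis unfolding X by eventually_elim auto
  qed
  then have "AE z in lborel. \<forall>X\<in>D. z \<in> X \<longrightarrow> f z = 0"
    using D(1) by (subst AE_ball_countable) auto
  then show ?thesis
    by eventually_elim (use D(4) in blast)
qed

section \<open>Continuity of translations in the L1 norm\<close>

lemma lborel_integral_translate:
  fixes f :: "'a::euclidean_space \<Rightarrow> 'b::{banach, second_countable_topology}"
  assumes [measurable]: "f \<in> borel_measurable borel"
  shows "(LINT z|lborel. f (z + c)) = (LINT z|lborel. f z)"
proof -
  have "(LINT z|lborel. f z) = (LINT z|distr lborel borel ((+) c). f z)"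
    by (simp add: lborel_distr_plus)
  also have "\<dots> = (LINT z|lborel. f (z + c))"
    by (subst integral_distr) (auto simp: add.commute)
  finally show ?thesis by simp
qed

lemma lborel_integrable_translate:
  fixes f :: "'a::euclidean_space \<Rightarrow> 'b::{banach, second_countable_topology}"
  assumes "integrable lborel f"
  shows "integrable lborel (\<lambda>z. f (z + c))"
proof -
  have "integrable (distr lborel borel ((+) c)) f"
    using assms by (simp add: lborel_distr_plus)
  then have "integrable lborel (\<lambda>z. f (c + z))"
    by (subst (asm) integrable_distr_eq) (use assms in auto)
  then show ?thesis by (simp add: add.commute)
qed

definition L1_modulus :: "('a::euclidean_space \<Rightarrow> 'b::{banach, second_countable_topology}) \<Rightarrow> 'a \<Rightarrow> real" where
  "L1_modulus f w = (LINT z|lborel. norm (f (z + w) - f z))"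

lemma L1_modulus_nonneg [simp]: "L1_modulus f w \<ge> 0"
  by (simp add: L1_modulus_def)

lemma L1_modulus_add:
  assumes "integrable lborel f" "integrable lborel g"
  shows "L1_modulus (\<lambda>z. f z + g z) w \<le> L1_modulus f w + L1_modulus g w"
proof -
  note [simp] = assms lborel_integrable_translate[OF assms(1)] lborel_integrable_translate[OF assms(2)]
  have "L1_modulus (\<lambda>z. f z + g z) w \<le> (LINT z|lborel. norm (f (z + w) - f z) + norm (g (z + w) - g z))"
    unfolding L1_modulus_def by (intro integral_mono) (auto simp: norm_diff_triangle_ineq)
  also have "\<dots> = L1_modulus f w + L1_modulus g w"
    unfolding L1_modulus_def by (intro Bochner_Integration.integral_add) auto
  finally show ?thesis .
qed

lemma L1_modulus_le_norm:
  assumes "integrable lborel f"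
  shows "L1_modulus f w \<le> 2 * (LINT z|lborel. norm (f z))"
proof -
  have "L1_modulus f w \<le> (LINT z|lborel. norm (f (z + w)) + norm (f z))"
    unfolding L1_modulus_def using assms
    by (intro integral_mono) (auto intro!: lborel_integrable_translate norm_triangle_ineq4)
  also have "\<dots> = 2 * (LINT z|lborel. norm (f z))"
    using assms lborel_integrable_translate[OF assms, of w] lborel_integral_translate[of "\<lambda>z. norm (f z)" w]
    by (subst Bochner_Integration.integral_add) auto
  finally show ?thesis .
qed

text \<open>The moduli of \<open>f\<close> and \<open>h\<close> differ by at most twice the L1
  distance of the functions, uniformly in the shift, so the functions with vanishing modulus form an
  L1-closed set.\<close>

lemma L1_modulus_approx:
  assumes f: "integrable lborel f"
    and approx: "\<And>e. e > 0 \<Longrightarrow>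
      \<exists>h. integrable lborel h \<and> (L1_modulus h \<longlongrightarrow> 0) (at 0) \<and> (LINT z|lborel. norm (f z - h z)) < e"
  shows "(L1_modulus f \<longlongrightarrow> 0) (at 0)"
proof (rule order_tendstoI)
  fix e :: real assume "e > 0"
  then obtain h where h: "integrable lborel h" "(L1_modulus h \<longlongrightarrow> 0) (at 0)" "(LINT z|lborel. norm (f z - h z)) < e / 4"
    using approx[of "e / 4"] by auto
  have "L1_modulus f w \<le> L1_modulus h w + e / 2" for w
    using L1_modulus_add[of h "\<lambda>z. f z - h z" w] L1_modulus_le_norm[of "\<lambda>z. f z - h z" w] f h by simp
  then have imp: "L1_modulus f w < e" if "L1_modulus h w < e / 2" for w
    using that by (smt (verit) field_sum_of_halves)
  have "\<forall>\<^sub>F w in at 0. L1_modulus h w < e / 2"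
    using h(2) \<open>e > 0\<close> by (intro order_tendstoD) auto
  then show "\<forall>\<^sub>F w in at 0. L1_modulus f w < e"
    by (rule eventually_mono) (rule imp)
qed (intro always_eventually allI less_le_trans[OF _ L1_modulus_nonneg])

lemma L1_modulus_open:
  fixes U :: "'a::euclidean_space set" and c :: "'b::{banach, second_countable_topology}"
  assumes "open U" "emeasure lborel U < \<infinity>"
  shows "(L1_modulus (\<lambda>z. indicator U z *\<^sub>R c) \<longlongrightarrow> 0) (at 0)"
  unfolding tendsto_at_iff_sequentially
proof (intro allI impI)
  fix X :: "nat \<Rightarrow> 'a" assume X: "X \<longlonglongrightarrow> 0"
  let ?d = "\<lambda>w z. indicator U z - indicator U (z + w) :: real"
  have [measurable]: "U \<in> sets borel" using assms by auto
  have iU: "integrable lborel (indicator U :: 'a \<Rightarrow> real)"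
    using assms by auto
  note iUw = lborel_integrable_translate[OF iU]
  \<comment> \<open>The indicator of an open set is lower semicontinuous, so the positive part of \<open>?d\<close> tends to 0
    pointwise; since \<open>?d\<close> has integral 0, its positive and negative parts have the same integral.\<close>
  have "(\<lambda>k. LINT z|lborel. max 0 (?d (X k) z)) \<longlonglongrightarrow> (LINT z|(lborel :: 'a measure). (0::real))"
  proof (rule integral_dominated_convergence[where w = "indicator U"])
    show "AE z in lborel. (\<lambda>k. max 0 (?d (X k) z)) \<longlonglongrightarrow> 0"
    proof (rule AE_I2)
      fix z
      show "(\<lambda>k. max 0 (?d (X k) z)) \<longlonglongrightarrow> 0"
      proof (cases "z \<in> U")
        case True
        have "(\<lambda>k. z + X k) \<longlonglongrightarrow> z" using tendsto_add[OF tendsto_const X, of z] by simp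
        then have "\<forall>\<^sub>F k in sequentially. z + X k \<in> U"
          using True \<open>open U\<close> by (simp add: topological_tendstoD)
        then have "\<forall>\<^sub>F k in sequentially. max 0 (?d (X k) z) = 0"
          by (rule eventually_mono) (use True in auto)
        then show ?thesis by (rule tendsto_eventually)
      qed simp
    qed
  qed (use iU in \<open>auto simp: indicator_def\<close>)
  then have pos: "(\<lambda>k. LINT z|lborel. max 0 (?d (X k) z)) \<longlonglongrightarrow> 0" by simp
  have "L1_modulus (\<lambda>z. indicator U z *\<^sub>R c) w = 2 * norm c * (LINT z|lborel. max 0 (?d w z))" for w
  proof -
    have "norm (indicator U (z + w) *\<^sub>R c - indicator U z *\<^sub>R c) = norm c * (2 * max 0 (?d w z) - ?d w z)" for z
      by (auto simp: indicator_def)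
    moreover have "(LINT z|lborel. 2 * max 0 (?d w z) - ?d w z) = 2 * (LINT z|lborel. max 0 (?d w z)) - (LINT z|lborel. ?d w z)"
      using iU iUw by (subst Bochner_Integration.integral_diff) (auto intro!: integrable_max)
    moreover have "(LINT z|lborel. ?d w z) = 0"
      using iU iUw[of w] lborel_integral_translate[of "indicator U :: 'a \<Rightarrow> real" w]
      by (subst Bochner_Integration.integral_diff) auto
    ultimately show ?thesis by (simp add: L1_modulus_def)
  qed
  then show "(L1_modulus (\<lambda>z. indicator U z *\<^sub>R c) \<circ> X) \<longlonglongrightarrow> 0"
    using tendsto_mult_right_zero[OF pos, of "2 * norm c"] by (simp add: comp_def)
qed


text \<open>Induction over integrable functions: outer regularity reduces measurable sets to open
  ones, sums are handled by subadditivity of the modulus, and limits by L1 approximation.\<close>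

theorem L1_modulus_tendsto_0:
  fixes f :: "'a::euclidean_space \<Rightarrow> 'b::{banach, second_countable_topology}"
  assumes "integrable lborel f"
  shows "(L1_modulus f \<longlongrightarrow> 0) (at 0)"
  using assms
proof (induction rule: integrable_induct)
  case (base A c)
  then have [measurable]: "A \<in> sets borel" by simp
  have iA: "integrable lborel (indicator A :: 'a \<Rightarrow> real)" using base by auto
  show ?case
  proof (rule L1_modulus_approx)
    fix e :: real assume "e > 0"
    \<comment> \<open>The added 1 keeps the denominator positive when \<open>c = 0\<close> and makes
      the final estimate strict.\<close>
    then have e: "e / (norm c + 1) > 0" by (simp add: add_nonneg_pos)
    obtain U where U: "open U" "A \<subseteq> U" "emeasure lborel (U - A) < ennreal (e / (norm c + 1))"
      using outer_regular_lborel[OF \<open>A \<in> sets borel\<close> e] by blast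
    have "emeasure lborel U \<le> emeasure lborel (U - A) + emeasure lborel A"
      using U emeasure_subadditive[of "U - A" lborel A] by (simp add: Un_absorb2)
    also have "\<dots> < \<infinity>"
      using order.strict_trans[OF U(3) ennreal_less_top] base(2) by simp
    finally have Ufin: "emeasure lborel U < \<infinity>" .
    have "(LINT z|lborel. norm (indicator A z *\<^sub>R c - indicator U z *\<^sub>R c)) = (LINT z|lborel. indicator (U - A) z * norm c)"
      using U(2) by (intro Bochner_Integration.integral_cong) (auto simp: indicator_def)
    also have "\<dots> = measure lborel (U - A) * norm c" using U(1) by simp
    also have "\<dots> \<le> e / (norm c + 1) * norm c"
      using U(3) e by (intro mult_right_mono) (auto simp: measure_def enn2real_leI less_imp_le)
    also have "\<dots> < e / (norm c + 1) * (norm c + 1)"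
      using e by (intro mult_strict_left_mono) auto
    also have "\<dots> = e" by (simp add: add_nonneg_eq_0_iff)
    finally show "\<exists>h. integrable lborel h \<and> (L1_modulus h \<longlongrightarrow> 0) (at 0) \<and>
        (LINT z|lborel. norm (indicator A z *\<^sub>R c - h z)) < e"
      using L1_modulus_open[OF U(1) Ufin, of c] U(1) Ufin
      by (intro exI[of _ "\<lambda>z. indicator U z *\<^sub>R c"]) (auto intro!: integrable_scaleR_left)
  qed (use iA in auto)
next
  case (add f g)
  have "((\<lambda>w. L1_modulus f w + L1_modulus g w) \<longlongrightarrow> 0) (at 0)"
    using tendsto_add[OF add.IH] by simp
  then show ?case
    by (rule Lim_null_comparison[rotated]) (use L1_modulus_add[OF add.hyps] in auto)
next
  case (lim f s)
  show ?case
  proof (rule L1_modulus_approx[OF lim.hyps(4)])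
    fix e :: real assume "e > 0"
    have "(\<lambda>i. LINT z|lborel. norm (f z - s i z)) \<longlonglongrightarrow> (LINT z|(lborel :: 'a measure). (0::real))"
    \<comment> \<open>The approximants satisfy \<open>norm (s i z) \<le> 2 * norm (f z)\<close>,
      whence the factor 3 for the difference.\<close>
    proof (rule integral_dominated_convergence[where w = "\<lambda>z. 3 * norm (f z)"])
      note [measurable] = borel_measurable_integrable[OF lim.hyps(1)] borel_measurable_integrable[OF lim.hyps(4)]
      show "(\<lambda>z. norm (f z - s i z)) \<in> borel_measurable lborel" for i by measurable
      show "AE z in lborel. (\<lambda>i. norm (f z - s i z)) \<longlonglongrightarrow> 0"
      proof (rule AE_I2, rule tendsto_norm_zero)
        fix z :: 'a
        show "(\<lambda>i. f z - s i z) \<longlonglongrightarrow> 0"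
          using tendsto_diff[OF tendsto_const lim.hyps(2)[of z], of "f z"] by simp
      qed
      show "AE z in lborel. norm (norm (f z - s i z)) \<le> 3 * norm (f z)" for i
      proof (rule AE_I2)
        fix z :: 'a
        show "norm (norm (f z - s i z)) \<le> 3 * norm (f z)"
          using lim.hyps(3)[of z i] norm_triangle_ineq4[of "f z" "s i z"] by simp
      qed
    qed (use lim.hyps(4) in auto)
    then have "(\<lambda>i. LINT z|lborel. norm (f z - s i z)) \<longlonglongrightarrow> 0" by simp
    then have "\<forall>\<^sub>F i in sequentially. (LINT z|lborel. norm (f z - s i z)) < e"
      using \<open>e > 0\<close> by (rule order_tendstoD)
    then obtain i where "(LINT z|lborel. norm (f z - s i z)) < e"
      by (auto simp: eventually_sequentially)
    with lim.hyps(1) lim.IH show "\<exists>h. integrable lborel h \<and> (L1_modulus h \<longlongrightarrow> 0) (at 0) \<and> (LINT z|lborel. norm (f z - h z)) < e"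
      by blast
  qed
qed

section \<open>Superpositions of translates\<close>

text \<open>The separate parameter space covers two uses at once: with \<open>a w = w\<close> and a
  kernel \<open>\<kappa>\<close> of mass 1 it is a moving average, and with
  \<open>a s = s *\<^sub>R d\<close> and the indicator of an interval it is the integral of
  \<open>u\<close> along a segment.\<close>

definition translates ::
    "('c::euclidean_space \<Rightarrow> 'a::euclidean_space) \<Rightarrow> ('c \<Rightarrow> real) \<Rightarrow>
      ('a \<Rightarrow> 'b::{banach, second_countable_topology}) \<Rightarrow> 'a \<Rightarrow> 'b" where
  "translates a \<kappa> u z = (LINT w|lborel. \<kappa> w *\<^sub>R u (z + a w))"

context
  fixes a :: "'c::euclidean_space \<Rightarrow> 'a::euclidean_space" and \<kappa> :: "'c \<Rightarrow> real"
    and u :: "'a \<Rightarrow> 'b::{banach, second_countable_topology}"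
  assumes a [measurable]: "a \<in> borel_measurable borel"
    and \<kappa>: "integrable lborel \<kappa>" and u: "integrable lborel u"
begin

text \<open>A shift preserves the L1 norm, so the double integral of the norm is the product of the
  L1 norms of \<open>\<kappa>\<close> and \<open>u\<close>. This joint integrability justifies the
  interchanges of integrals that follow.\<close>

lemma integrable_translates_pair:
  "integrable (lborel \<Otimes>\<^sub>M lborel) (\<lambda>(z, w). \<kappa> w *\<^sub>R u (z + a w))"
proof -
  note [measurable] = borel_measurable_integrable[OF \<kappa>] borel_measurable_integrable[OF u]
  have "integrable (lborel \<Otimes>\<^sub>M lborel) (\<lambda>(w, z). \<kappa> w *\<^sub>R u (z + a w))"
  proof (rule lborel_pair.Fubini_integrable)
    have "(\<lambda>w. LINT z|lborel. norm (\<kappa> w *\<^sub>R u (z + a w))) = (\<lambda>w. \<bar>\<kappa> w\<bar> * (LINT z|lborel. norm (u z)))"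
      using lborel_integral_translate[of "\<lambda>z. norm (u z)"] by simp
    then show "integrable lborel (\<lambda>w. LINT z|lborel. norm (case (w, z) of (w, z) \<Rightarrow> \<kappa> w *\<^sub>R u (z + a w)))"
      using \<kappa> by simp
  qed (auto intro!: lborel_integrable_translate u integrable_scaleR_right)
  from lborel_pair.integrable_product_swap[OF this] show ?thesis
    by (simp add: case_prod_unfold)
qed

lemma integrable_translates: "integrable lborel (translates a \<kappa> u)"
  unfolding translates_def using lborel_pair.integrable_fst'[OF integrable_translates_pair] by simp

lemma borel_measurable_translates [measurable]: "translates a \<kappa> u \<in> borel_measurable borel"
  using borel_measurable_integrable[OF integrable_translates] by simp

end

text \<open>The equality can fail on a null set: where the vector integrand is not integrable its
  integral is 0 by convention, although a single component may still be integrable.\<close>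

lemma translates_inner:
  fixes u :: "'a::euclidean_space \<Rightarrow> 'b::euclidean_space"
  assumes "a \<in> borel_measurable borel" "integrable lborel \<kappa>" "integrable lborel u"
  shows "AE z in lborel. translates a \<kappa> u z \<bullet> e = translates a \<kappa> (\<lambda>z. u z \<bullet> e) z"
  using lborel_pair.AE_integrable_fst'[OF integrable_translates_pair[OF assms]]
proof eventually_elim
  case (elim z)
  then show ?case
    unfolding translates_def
    by (subst integral_inner_left[symmetric]) auto
qed

text \<open>Fubini and a shift of \<open>z\<close>. The first form puts each single shift on
  \<open>\<psi>\<close>, where the definition of a weak gradient can be applied; the second is the
  adjoint relation, with the averaging of \<open>\<psi>\<close> running in the opposite
  direction.\<close>

lemma integral_translates_mult:
  fixes a :: "'c::euclidean_space \<Rightarrow> 'a::euclidean_space" and u \<psi> :: "'a \<Rightarrow> real"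
  assumes a [measurable]: "a \<in> borel_measurable borel"
    and \<kappa>: "integrable lborel \<kappa>" and u: "integrable lborel u"
    and \<psi> [measurable]: "\<psi> \<in> borel_measurable borel" and bd: "\<And>z. \<bar>\<psi> z\<bar> \<le> B"
  shows "(LINT z|lborel. translates a \<kappa> u z * \<psi> z) = (LINT w|lborel. \<kappa> w * (LINT z|lborel. u z * \<psi> (z - a w)))"
    and "(LINT z|lborel. translates a \<kappa> u z * \<psi> z) = (LINT z|lborel. u z * translates (\<lambda>w. - a w) \<kappa> \<psi> z)"
proof -
  note [measurable] = borel_measurable_integrable[OF \<kappa>] borel_measurable_integrable[OF u]
  have int: "integrable (lborel \<Otimes>\<^sub>M lborel) (\<lambda>(z, w). \<kappa> w * u (z + a w) * \<psi> z)"
  proof (rule Bochner_Integration.integrable_bound)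
    show "integrable (lborel \<Otimes>\<^sub>M lborel) (\<lambda>x. B * (case x of (z, w) \<Rightarrow> \<kappa> w *\<^sub>R u (z + a w)))"
      by (intro integrable_mult_right integrable_translates_pair a \<kappa> u)
    show "AE x in lborel \<Otimes>\<^sub>M lborel. norm (case x of (z, w) \<Rightarrow> \<kappa> w * u (z + a w) * \<psi> z)
        \<le> norm (B * (case x of (z, w) \<Rightarrow> \<kappa> w *\<^sub>R u (z + a w)))"
    proof (rule AE_I2, clarify)
      fix z :: 'a and w :: 'c
      have "\<bar>\<kappa> w * u (z + a w)\<bar> * \<bar>\<psi> z\<bar> \<le> \<bar>\<kappa> w * u (z + a w)\<bar> * \<bar>B\<bar>"
        using bd[of z] by (intro mult_left_mono) auto
      then show "norm (\<kappa> w * u (z + a w) * \<psi> z) \<le> norm (B * \<kappa> w *\<^sub>R u (z + a w))"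
        by (simp add: abs_mult mult.commute)
    qed
  qed measurable
  \<comment> \<open>For fixed \<open>w\<close> this is the previous integrand with \<open>z\<close>
    shifted by \<open>a w\<close>; its joint integrability is a separate fact, used to exchange the
    integrals back in the second identity.\<close>
  have int': "integrable (lborel \<Otimes>\<^sub>M lborel) (\<lambda>(w, z). \<kappa> w * u z * \<psi> (z - a w))"
  proof (rule lborel_pair.Fubini_integrable)
    have sh: "(LINT z|lborel. norm (\<kappa> w * u z * \<psi> (z - a w))) = (LINT z|lborel. norm (\<kappa> w * u (z + a w) * \<psi> z))" for w
      using lborel_integral_translate[of "\<lambda>z. norm (\<kappa> w * u z * \<psi> (z - a w))" "a w"] by simp
    have "integrable lborel (\<lambda>w. LINT z|lborel. norm (\<kappa> w * u (z + a w) * \<psi> z))"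
      using integrable_norm[OF int]
      by (intro lborel_pair.integrable_snd) (simp add: case_prod_unfold)
    then show "integrable lborel (\<lambda>w. LINT z|lborel. norm (case (w, z) of (w, z) \<Rightarrow> \<kappa> w * u z * \<psi> (z - a w)))"
      by (simp add: sh[unfolded real_norm_def])
    show "AE w in lborel. integrable lborel (\<lambda>z. case (w, z) of (w, z) \<Rightarrow> \<kappa> w * u z * \<psi> (z - a w))"
    proof (rule AE_I2)
      fix w
      have "integrable lborel (\<lambda>z. B * (\<kappa> w * u z))" using u by simp
      then have "integrable lborel (\<lambda>z. \<kappa> w * u z * \<psi> (z - a w))"
      proof (rule Bochner_Integration.integrable_bound)
        show "AE z in lborel. norm (\<kappa> w * u z * \<psi> (z - a w)) \<le> norm (B * (\<kappa> w * u z))"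
        proof (rule AE_I2)
          fix z
          have "\<bar>\<kappa> w * u z\<bar> * \<bar>\<psi> (z - a w)\<bar> \<le> \<bar>\<kappa> w * u z\<bar> * \<bar>B\<bar>"
            using bd[of "z - a w"] by (intro mult_left_mono) auto
          then show "norm (\<kappa> w * u z * \<psi> (z - a w)) \<le> norm (B * (\<kappa> w * u z))"
            by (simp add: abs_mult mult.commute)
        qed
      qed measurable
      then show "integrable lborel (\<lambda>z. case (w, z) of (w, z) \<Rightarrow> \<kappa> w * u z * \<psi> (z - a w))" by simp
    qed
  qed measurable
  have "(LINT z|lborel. translates a \<kappa> u z * \<psi> z) = (LINT z|lborel. LINT w|lborel. \<kappa> w * u (z + a w) * \<psi> z)"
    by (simp add: translates_def)
  also have "\<dots> = (LINT w|lborel. LINT z|lborel. \<kappa> w * u (z + a w) * \<psi> z)"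
    using lborel_pair.Fubini_integral[OF int] by simp
  also have "\<dots> = (LINT w|lborel. LINT z|lborel. \<kappa> w * u z * \<psi> (z - a w))"
    using lborel_integral_translate[of "\<lambda>z. \<kappa> w * u z * \<psi> (z - a w)" "a w" for w] by simp
  finally have eq: "(LINT z|lborel. translates a \<kappa> u z * \<psi> z) = (LINT w|lborel. LINT z|lborel. \<kappa> w * u z * \<psi> (z - a w))" .
  then show "(LINT z|lborel. translates a \<kappa> u z * \<psi> z) = (LINT w|lborel. \<kappa> w * (LINT z|lborel. u z * \<psi> (z - a w)))"
    by (simp add: mult.assoc)
  have "(LINT w|lborel. LINT z|lborel. \<kappa> w * u z * \<psi> (z - a w)) = (LINT z|lborel. LINT w|lborel. \<kappa> w * u z * \<psi> (z - a w))"
    using lborel_pair.Fubini_integral[OF int'] by simp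
  also have "\<dots> = (LINT z|lborel. u z * translates (\<lambda>w. - a w) \<kappa> \<psi> z)"
    unfolding translates_def by (simp flip: integral_mult_right_zero add: mult_ac)
  finally show "(LINT z|lborel. translates a \<kappa> u z * \<psi> z) = (LINT z|lborel. u z * translates (\<lambda>w. - a w) \<kappa> \<psi> z)"
    using eq by simp
qed

text \<open>Since \<open>\<kappa>\<close> has mass 1, the difference is the
  \<open>\<kappa>\<close>-average of \<open>u (z + a w) - u z\<close>, and Minkowski's integral
  inequality bounds its norm by the average of the moduli over the support of
  \<open>\<kappa>\<close>.\<close>

lemma translates_L1_distance:
  fixes a :: "'c::euclidean_space \<Rightarrow> 'a::euclidean_space" and u :: "'a \<Rightarrow> 'b::{banach, second_countable_topology}"
  assumes a [measurable]: "a \<in> borel_measurable borel"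
    and \<kappa>: "integrable lborel \<kappa>" "\<And>w. \<kappa> w \<ge> 0" "(LINT w|lborel. \<kappa> w) = 1" and u: "integrable lborel u"
    and mod: "\<And>w. \<kappa> w \<noteq> 0 \<Longrightarrow> L1_modulus u (a w) \<le> e"
  shows "(LINT z|lborel. norm (translates a \<kappa> u z - u z)) \<le> e"
proof -
  note [measurable] = borel_measurable_integrable[OF \<kappa>(1)] borel_measurable_integrable[OF u]
  have i1: "integrable (lborel \<Otimes>\<^sub>M lborel) (\<lambda>(z, w). \<kappa> w *\<^sub>R u (z + a w))"
    by (rule integrable_translates_pair[OF a \<kappa>(1) u])
  have i2: "integrable (lborel \<Otimes>\<^sub>M lborel) (\<lambda>(z, w). \<kappa> w *\<^sub>R u z)"
    using integrable_translates_pair[of "\<lambda>_. 0", OF _ \<kappa>(1) u] by simp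
  have i: "integrable (lborel \<Otimes>\<^sub>M lborel) (\<lambda>(z, w). norm (\<kappa> w *\<^sub>R (u (z + a w) - u z)))"
    using integrable_norm[OF Bochner_Integration.integrable_diff[OF i1 i2]]
    by (simp add: case_prod_unfold algebra_simps)
  have "(LINT z|lborel. norm (translates a \<kappa> u z - u z)) \<le> (LINT z|lborel. LINT w|lborel. norm (\<kappa> w *\<^sub>R (u (z + a w) - u z)))"
  proof (rule integral_mono_AE)
    show "integrable lborel (\<lambda>z. norm (translates a \<kappa> u z - u z))"
      using integrable_translates[OF a \<kappa>(1) u] u by simp
    show "integrable lborel (\<lambda>z. LINT w|lborel. norm (\<kappa> w *\<^sub>R (u (z + a w) - u z)))"
      using lborel_pair.integrable_fst'[OF i] by simp
    show "AE z in lborel. norm (translates a \<kappa> u z - u z) \<le> (LINT w|lborel. norm (\<kappa> w *\<^sub>R (u (z + a w) - u z)))"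
      using lborel_pair.AE_integrable_fst'[OF i1]
    proof eventually_elim
      case (elim z)
      have "translates a \<kappa> u z - u z = (LINT w|lborel. \<kappa> w *\<^sub>R u (z + a w)) - (LINT w|lborel. \<kappa> w *\<^sub>R u z)"
        using \<kappa>(1,3) by (simp add: translates_def)
      also have "\<dots> = (LINT w|lborel. \<kappa> w *\<^sub>R (u (z + a w) - u z))"
        using elim \<kappa>(1) by (subst Bochner_Integration.integral_diff[symmetric]) (auto simp: scaleR_diff_right)
      finally show ?case by (simp only: integral_norm_bound)
    qed
  qed
  also have "\<dots> = (LINT w|lborel. LINT z|lborel. norm (\<kappa> w *\<^sub>R (u (z + a w) - u z)))"
    using lborel_pair.Fubini_integral[OF i] by simp
  also have "\<dots> = (LINT w|lborel. \<kappa> w * L1_modulus u (a w))"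
    using \<kappa>(2) by (simp add: L1_modulus_def)
  also have "\<dots> \<le> (LINT w|lborel. \<kappa> w * e)"
  proof (rule integral_mono)
    have "integrable lborel (\<lambda>w. LINT z|lborel. norm (\<kappa> w *\<^sub>R (u (z + a w) - u z)))"
      using lborel_pair.integrable_snd[OF i] by simp
    then show "integrable lborel (\<lambda>w. \<kappa> w * L1_modulus u (a w))"
      using \<kappa>(2) by (simp add: L1_modulus_def)
    show "\<kappa> w * L1_modulus u (a w) \<le> \<kappa> w * e" for w
      using mod[of w] \<kappa>(2)[of w] by (cases "\<kappa> w = 0") (auto intro: mult_left_mono)
  qed (use \<kappa>(1) in simp)
  also have "\<dots> = e" using \<kappa>(3) by simp
  finally show ?thesis .
qed

text \<open>Moving \<open>z\<close> by \<open>h\<close> changes the average by at most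
  \<open>B * L1_modulus u h\<close>. Continuity comes from that of translations in L1, so a kernel
  with jumps is allowed.\<close>

lemma translates_continuous:
  fixes u :: "'a::euclidean_space \<Rightarrow> real"
  assumes \<kappa>: "\<kappa> \<in> borel_measurable borel" "\<And>w. \<bar>\<kappa> w\<bar> \<le> B" and u: "integrable lborel u"
  shows "continuous_on UNIV (translates (\<lambda>w. w) \<kappa> u)"
proof -
  note [measurable] = \<kappa>(1) borel_measurable_integrable[OF u]
  have B: "B \<ge> 0" using \<kappa>(2)[of 0] by linarith
  have int: "integrable lborel (\<lambda>w. \<kappa> w * u (z + w))" for z
  proof (rule Bochner_Integration.integrable_bound)
    show "integrable lborel (\<lambda>w. B * u (z + w))"
      using lborel_integrable_translate[OF u, of z] by (simp add: add.commute)
    show "AE w in lborel. norm (\<kappa> w * u (z + w)) \<le> norm (B * u (z + w))"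
      using \<kappa>(2) B by (auto simp: abs_mult intro!: mult_right_mono)
  qed measurable
  have bound: "\<bar>translates (\<lambda>w. w) \<kappa> u (z + h) - translates (\<lambda>w. w) \<kappa> u z\<bar> \<le> B * L1_modulus u h" for z h
  proof -
    have "translates (\<lambda>w. w) \<kappa> u (z + h) - translates (\<lambda>w. w) \<kappa> u z = (LINT w|lborel. \<kappa> w * u (z + h + w) - \<kappa> w * u (z + w))"
      unfolding translates_def using int by simp
    also have "\<bar>\<dots>\<bar> \<le> (LINT w|lborel. B * norm (u (w + z + h) - u (w + z)))"
    proof (rule integral_abs_bound[THEN order_trans], rule integral_mono)
      show "integrable lborel (\<lambda>w. \<bar>\<kappa> w * u (z + h + w) - \<kappa> w * u (z + w)\<bar>)"
        using int by simp
      have "integrable lborel (\<lambda>z. u (z + h) - u z)"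
        using u lborel_integrable_translate[OF u] by simp
      from lborel_integrable_translate[OF this, of z]
      show "integrable lborel (\<lambda>w. B * norm (u (w + z + h) - u (w + z)))" by simp
      show "\<bar>\<kappa> w * u (z + h + w) - \<kappa> w * u (z + w)\<bar> \<le> B * norm (u (w + z + h) - u (w + z))" for w
        using mult_right_mono[OF \<kappa>(2)[of w], of "\<bar>u (w + z + h) - u (w + z)\<bar>"]
        by (simp add: abs_mult[symmetric] right_diff_distrib add_ac)
    qed
    also have "\<dots> = B * L1_modulus u h"
      unfolding L1_modulus_def using lborel_integral_translate[of "\<lambda>w. norm (u (w + h) - u w)" z] by simp
    finally show ?thesis .
  qed
  have "((\<lambda>h. translates (\<lambda>w. w) \<kappa> u (z + h) - translates (\<lambda>w. w) \<kappa> u z) \<longlongrightarrow> 0) (at 0)" for z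
    by (rule Lim_null_comparison[OF _ tendsto_mult_right_zero[OF L1_modulus_tendsto_0[OF u], of B]])
       (auto intro!: always_eventually bound)
  then have "((\<lambda>h. translates (\<lambda>w. w) \<kappa> u (z + h)) \<longlongrightarrow> translates (\<lambda>w. w) \<kappa> u z) (at 0)" for z
    by (simp add: LIM_zero_iff)
  then have "isCont (translates (\<lambda>w. w) \<kappa> u) z" for z
    by (simp add: isCont_iff)
  then show ?thesis by (simp add: continuous_at_imp_continuous_on)
qed

section \<open>Weak gradients\<close>

lemma half_space_eq: "half_space = UNIV \<times> {0<..}"
  by (auto simp: half_space_def)

lemma mem_half_space [simp]: "(x, y) \<in> half_space \<longleftrightarrow> y > 0"
  by (simp add: half_space_def)

lemma mem_half_space_iff: "z \<in> half_space \<longleftrightarrow> snd z > 0"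
  by (cases z) simp

lemma open_half_space: "open half_space"
  by (auto simp: half_space_eq intro!: open_Times)

lemma half_space_borel [measurable]: "half_space \<in> sets borel"
  by (rule borel_open[OF open_half_space])

text \<open>Turns integrals over the half-space into integrals over the whole space, where
  translation invariance is available. Nothing is claimed about weak derivatives across the
  boundary: test functions still have support in the open half-space.\<close>

definition zero_ext :: "((real^'n) \<times> real \<Rightarrow> 'b::real_vector) \<Rightarrow> (real^'n) \<times> real \<Rightarrow> 'b" where
  "zero_ext u z = indicator half_space z *\<^sub>R u z"

lemma integrable_zero_ext_iff: "integrable lborel (zero_ext u) \<longleftrightarrow> set_integrable lborel half_space u"
  by (simp add: zero_ext_def[abs_def] set_integrable_def)

lemma zero_ext_eq [simp]: "z \<in> half_space \<Longrightarrow> zero_ext u z = u z"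
  and zero_ext_outside [simp]: "z \<notin> half_space \<Longrightarrow> zero_ext u z = 0"
  by (auto simp: zero_ext_def)

lemma integrable_mult_bounded:
  fixes u \<psi> :: "'a \<Rightarrow> real"
  assumes u: "integrable M u" and [measurable]: "\<psi> \<in> borel_measurable M" and bd: "\<And>z. \<bar>\<psi> z\<bar> \<le> B"
  shows "integrable M (\<lambda>z. u z * \<psi> z)"
proof (rule Bochner_Integration.integrable_bound)
  note [measurable] = borel_measurable_integrable[OF u]
  show "(\<lambda>z. u z * \<psi> z) \<in> borel_measurable M" by measurable
  show "integrable M (\<lambda>z. B * u z)" using u by simp
  show "AE z in M. norm (u z * \<psi> z) \<le> norm (B * u z)"
  proof (rule AE_I2)
    fix z
    have "\<bar>u z\<bar> * \<bar>\<psi> z\<bar> \<le> \<bar>u z\<bar> * \<bar>B\<bar>"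
      using bd[of z] by (intro mult_left_mono) auto
    then show "norm (u z * \<psi> z) \<le> norm (B * u z)" by (simp add: abs_mult mult.commute)
  qed
qed

lemma test_function_borel_measurable:
  "test_function S \<phi> \<Longrightarrow> \<phi> \<in> borel_measurable borel"
  "test_function S \<phi> \<Longrightarrow> (\<lambda>z. frechet_derivative \<phi> (at z) v) \<in> borel_measurable borel"
  by (auto intro!: borel_measurable_continuous_onI test_function_continuous test_function_derivative_continuous)

lemma integrable_mult_test_function:
  assumes "integrable lborel u" "test_function S \<phi>"
  shows "integrable lborel (\<lambda>z. u z * \<phi> z)" "integrable lborel (\<lambda>z. u z * frechet_derivative \<phi> (at z) v)"
proof -
  obtain B where "\<And>z. \<bar>\<phi> z\<bar> \<le> B" using test_function_bounded[OF assms(2)] by blast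
  then show "integrable lborel (\<lambda>z. u z * \<phi> z)"
    using assms test_function_borel_measurable(1)[OF assms(2)] by (intro integrable_mult_bounded) auto
  obtain C where "\<And>z. \<bar>frechet_derivative \<phi> (at z) v\<bar> \<le> C"
    using test_function_derivative_bounded[OF assms(2)] by blast
  then show "integrable lborel (\<lambda>z. u z * frechet_derivative \<phi> (at z) v)"
    using assms test_function_borel_measurable(2)[OF assms(2)] by (intro integrable_mult_bounded) auto
qed

text \<open>A test function and its derivative vanish off the half-space, so the identity may be
  checked with integrals over the whole space, whatever values \<open>u\<close> and \<open>g\<close>
  take below.\<close>

lemma L1_weak_gradientI:
  assumes "set_integrable lborel half_space g"
    and "\<And>\<phi> e. test_function half_space \<phi> \<Longrightarrow> e \<in> Basis \<Longrightarrow>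
      (LINT z|lborel. u z * frechet_derivative \<phi> (at z) e) = - (LINT z|lborel. (g z \<bullet> e) * \<phi> z)"
  shows "L1_weak_gradient u g"
proof -
  have "(LINT z:half_space|lborel. u z * frechet_derivative \<phi> (at z) e) = (LINT z|lborel. u z * frechet_derivative \<phi> (at z) e)"
    "(LINT z:half_space|lborel. (g z \<bullet> e) * \<phi> z) = (LINT z|lborel. (g z \<bullet> e) * \<phi> z)"
    if "test_function half_space \<phi>" for \<phi> e
    unfolding set_lebesgue_integral_def
    using test_function_outside[OF that] test_function_derivative_outside[OF that, of _ e]
    by (auto intro!: Bochner_Integration.integral_cong simp: indicator_def)
  with assms show ?thesis by (auto simp: L1_weak_gradient_def)
qed

lemma L1_weak_gradientD:
  assumes "L1_weak_gradient u g"
  shows "integrable lborel (zero_ext g)"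
    and "test_function half_space \<phi> \<Longrightarrow> e \<in> Basis \<Longrightarrow>
      (LINT z|lborel. zero_ext u z * frechet_derivative \<phi> (at z) e) = - (LINT z|lborel. (zero_ext g z \<bullet> e) * \<phi> z)"
proof -
  show "integrable lborel (zero_ext g)"
    using assms by (simp add: L1_weak_gradient_def integrable_zero_ext_iff)
  show "(LINT z|lborel. zero_ext u z * frechet_derivative \<phi> (at z) e) = - (LINT z|lborel. (zero_ext g z \<bullet> e) * \<phi> z)"
    if "test_function half_space \<phi>" "e \<in> Basis"
    using assms that by (simp add: L1_weak_gradient_def zero_ext_def set_lebesgue_integral_def mult.assoc)
qed

lemma L1_weak_gradient_zero_ext:
  fixes u :: "(real^'n) \<times> real \<Rightarrow> real"
  shows "L1_weak_gradient (zero_ext u) (zero_ext g) \<longleftrightarrow> L1_weak_gradient u g"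
proof -
  have "indicator half_space z *\<^sub>R zero_ext g z = indicator half_space z *\<^sub>R g z" for z :: "(real^'n) \<times> real"
    by (auto simp: indicator_def)
  moreover have "indicator half_space z *\<^sub>R (zero_ext u z * c) = indicator half_space z *\<^sub>R (u z * c)"
    for z :: "(real^'n) \<times> real" and c :: real
    by (auto simp: indicator_def)
  moreover have "indicator half_space z *\<^sub>R ((zero_ext g z \<bullet> e) * c) = indicator half_space z *\<^sub>R ((g z \<bullet> e) * c)"
    for z e :: "(real^'n) \<times> real" and c :: real
    by (auto simp: indicator_def)
  ultimately show ?thesis
    unfolding L1_weak_gradient_def set_integrable_def set_lebesgue_integral_def by (simp only:)
qed

lemma L1_weak_gradient_diff:
  fixes u v :: "(real^'n) \<times> real \<Rightarrow> real"
  assumes u: "set_integrable lborel half_space u" "L1_weak_gradient u g"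
    and v: "set_integrable lborel half_space v" "L1_weak_gradient v h"
  shows "L1_weak_gradient (\<lambda>z. u z - v z) (\<lambda>z. g z - h z)"
proof -
  have "zero_ext (\<lambda>z. u z - v z) = (\<lambda>z. zero_ext u z - zero_ext v z)"
    "zero_ext (\<lambda>z. g z - h z) = (\<lambda>z. zero_ext g z - zero_ext h z)"
    by (auto simp: zero_ext_def fun_eq_iff scaleR_diff_right right_diff_distrib)
  moreover have "L1_weak_gradient (\<lambda>z. zero_ext u z - zero_ext v z) (\<lambda>z. zero_ext g z - zero_ext h z)"
  proof (rule L1_weak_gradientI)
    have int: "integrable lborel (zero_ext u)" "integrable lborel (zero_ext v)"
      "integrable lborel (zero_ext g)" "integrable lborel (zero_ext h)"
      using assms by (auto simp: integrable_zero_ext_iff L1_weak_gradient_def)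
    then have "integrable lborel (\<lambda>z. zero_ext g z - zero_ext h z)" by simp
    then show "set_integrable lborel half_space (\<lambda>z. zero_ext g z - zero_ext h z)"
      unfolding set_integrable_def by (intro integrable_mult_indicator) auto
    fix \<phi> :: "(real^'n) \<times> real \<Rightarrow> real" and e :: "(real^'n) \<times> real"
    assume \<phi>: "test_function half_space \<phi>" and e: "e \<in> Basis"
    have "integrable lborel (\<lambda>z. zero_ext g z \<bullet> e)" "integrable lborel (\<lambda>z. zero_ext h z \<bullet> e)"
      using int by auto
    note i = this[THEN integrable_mult_test_function(1)[OF _ \<phi>]]
      int(1,2)[THEN integrable_mult_test_function(2)[OF _ \<phi>]]
    show "(LINT z|lborel. (zero_ext u z - zero_ext v z) * frechet_derivative \<phi> (at z) e) =
        - (LINT z|lborel. (zero_ext g z - zero_ext h z) \<bullet> e * \<phi> z)"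
      using i L1_weak_gradientD(2)[OF u(2) \<phi> e] L1_weak_gradientD(2)[OF v(2) \<phi> e]
      by (simp add: left_diff_distrib inner_diff_left)
  qed
  ultimately show ?thesis
    by (metis L1_weak_gradient_zero_ext)
qed

text \<open>The fundamental lemma is applied to each component of the difference. This makes the
  choice in \<open>weak_grad\<close> harmless: a gradient computed by hand agrees with it almost
  everywhere.\<close>

lemma L1_weak_gradient_unique:
  fixes u :: "(real^'n) \<times> real \<Rightarrow> real"
  assumes "L1_weak_gradient u g" "L1_weak_gradient u h"
  shows "AE z in lborel. z \<in> half_space \<longrightarrow> g z = h z"
proof -
  note int = assms[THEN L1_weak_gradientD(1)]
  have "AE z in lborel. z \<in> half_space \<longrightarrow> (zero_ext g z - zero_ext h z) \<bullet> e = 0" if e: "e \<in> Basis" for e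
  proof (rule test_function_integrals_zero_imp_AE_zero[OF _ open_half_space])
    have "integrable lborel (\<lambda>z. (zero_ext g z - zero_ext h z) \<bullet> e)" using int by simp
    then show "set_integrable lborel half_space (\<lambda>z. (zero_ext g z - zero_ext h z) \<bullet> e)"
      unfolding set_integrable_def by (intro integrable_mult_indicator) auto
    fix \<phi> :: "(real^'n) \<times> real \<Rightarrow> real" assume \<phi>: "test_function half_space \<phi>"
    have "integrable lborel (\<lambda>z. zero_ext g z \<bullet> e)" "integrable lborel (\<lambda>z. zero_ext h z \<bullet> e)"
      using int by auto
    note i = this[THEN integrable_mult_test_function(1)[OF _ \<phi>]]
    have "(LINT z:half_space|lborel. ((zero_ext g z - zero_ext h z) \<bullet> e) * \<phi> z) =
       (LINT z|lborel. (zero_ext g z \<bullet> e) * \<phi> z - (zero_ext h z \<bullet> e) * \<phi> z)"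
      unfolding set_lebesgue_integral_def
      by (intro Bochner_Integration.integral_cong) (auto simp: indicator_def algebra_simps inner_diff_left)
    also have "\<dots> = 0"
      using i L1_weak_gradientD(2)[OF assms(1) \<phi> e] L1_weak_gradientD(2)[OF assms(2) \<phi> e] by simp
    finally show "(LINT z:half_space|lborel. ((zero_ext g z - zero_ext h z) \<bullet> e) * \<phi> z) = 0" .
  qed
  then have "AE z in lborel. \<forall>e\<in>Basis. z \<in> half_space \<longrightarrow> (zero_ext g z - zero_ext h z) \<bullet> e = 0"
    by (subst AE_ball_countable) (simp_all add: countable_finite)
  then show ?thesis
  proof (rule eventually_mono, intro impI)
    fix z :: "(real^'n) \<times> real"
    assume *: "\<forall>e\<in>Basis. z \<in> half_space \<longrightarrow> (zero_ext g z - zero_ext h z) \<bullet> e = 0" and z: "z \<in> half_space"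
    show "g z = h z"
      by (rule euclidean_eqI) (use * z in \<open>auto simp: inner_diff_left\<close>)
  qed
qed

lemma weak_grad_weak_gradient: "L1_weak_gradient u g \<Longrightarrow> L1_weak_gradient u (weak_grad u)"
  unfolding weak_grad_def by (rule someI[of "L1_weak_gradient u"])

lemma weak_grad_AE:
  "L1_weak_gradient u g \<Longrightarrow> AE z in lborel. z \<in> half_space \<longrightarrow> weak_grad u z = g z"
  by (rule L1_weak_gradient_unique[OF weak_grad_weak_gradient])

lemma W11_weak_grad: "u \<in> W11 \<Longrightarrow> L1_weak_gradient u (weak_grad u)"
  by (auto simp: W11_def intro: weak_grad_weak_gradient)

lemma W11_zero_ext_integrable:
  assumes "u \<in> W11"
  shows "integrable lborel (zero_ext u)" "integrable lborel (zero_ext (weak_grad u))"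
  using assms W11_weak_grad[OF assms] L1_weak_gradientD(1) by (auto simp: W11_def integrable_zero_ext_iff)

text \<open>Averaging commutes with the weak gradient because each shift can be put on the test
  function; \<open>up\<close> makes every shift that carries weight keep the support in the
  half-space.\<close>

lemma L1_weak_gradient_translates:
  fixes u :: "(real^'n) \<times> real \<Rightarrow> real" and a :: "'c::euclidean_space \<Rightarrow> (real^'n) \<times> real"
  assumes a [measurable]: "a \<in> borel_measurable borel" and \<kappa>: "integrable lborel \<kappa>"
    and up: "\<And>w. \<kappa> w \<noteq> 0 \<Longrightarrow> snd (a w) \<ge> 0"
    and u: "set_integrable lborel half_space u" and g: "L1_weak_gradient u g"
  shows "L1_weak_gradient (translates a \<kappa> (zero_ext u)) (translates a \<kappa> (zero_ext g))"
proof (rule L1_weak_gradientI)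
  have u0: "integrable lborel (zero_ext u)" using u by (simp add: integrable_zero_ext_iff)
  note g0 = L1_weak_gradientD(1)[OF g]
  show "set_integrable lborel half_space (translates a \<kappa> (zero_ext g))"
    unfolding set_integrable_def by (intro integrable_mult_indicator integrable_translates a \<kappa> g0) auto
  fix \<phi> :: "(real^'n) \<times> real \<Rightarrow> real" and e :: "(real^'n) \<times> real"
  assume \<phi>: "test_function half_space \<phi>" and e: "e \<in> Basis"
  note [measurable] = test_function_borel_measurable[OF \<phi>]
  obtain B where B: "\<And>z. \<bar>\<phi> z\<bar> \<le> B" using test_function_bounded[OF \<phi>] by blast
  obtain C where C: "\<And>z. \<bar>frechet_derivative \<phi> (at z) e\<bar> \<le> C"
    using test_function_derivative_bounded[OF \<phi>] by blast
  have ge: "integrable lborel (\<lambda>z. zero_ext g z \<bullet> e)" using g0 by simp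
  have "(LINT z|lborel. translates a \<kappa> (zero_ext u) z * frechet_derivative \<phi> (at z) e) =
      (LINT w|lborel. \<kappa> w * (LINT z|lborel. zero_ext u z * frechet_derivative \<phi> (at (z - a w)) e))"
    by (rule integral_translates_mult(1)[OF a \<kappa> u0 _ C]) measurable
  also have "\<dots> = (LINT w|lborel. - (\<kappa> w * (LINT z|lborel. (zero_ext g z \<bullet> e) * \<phi> (z - a w))))"
  proof (rule Bochner_Integration.integral_cong[OF refl])
    fix w
    show "\<kappa> w * (LINT z|lborel. zero_ext u z * frechet_derivative \<phi> (at (z - a w)) e) =
      - (\<kappa> w * (LINT z|lborel. (zero_ext g z \<bullet> e) * \<phi> (z - a w)))"
    proof (cases "\<kappa> w = 0")
      case False
      have "test_function half_space (\<lambda>z. \<phi> (z - a w))"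
        using up[OF False] by (intro test_function_translate \<phi>) (auto simp: mem_half_space_iff)
      from L1_weak_gradientD(2)[OF g this e] show ?thesis
        by (simp add: frechet_derivative_translate[OF \<phi>])
    qed simp
  qed
  also have "\<dots> = - (LINT w|lborel. \<kappa> w * (LINT z|lborel. (zero_ext g z \<bullet> e) * \<phi> (z - a w)))"
    by simp
  also have "(LINT w|lborel. \<kappa> w * (LINT z|lborel. (zero_ext g z \<bullet> e) * \<phi> (z - a w))) =
      (LINT z|lborel. translates a \<kappa> (\<lambda>z. zero_ext g z \<bullet> e) z * \<phi> z)"
    by (rule integral_translates_mult(1)[OF a \<kappa> ge _ B, symmetric]) measurable
  also have "\<dots> = (LINT z|lborel. (translates a \<kappa> (zero_ext g) z \<bullet> e) * \<phi> z)"
  proof (rule integral_cong_AE)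
    note [measurable] = borel_measurable_translates[OF a \<kappa> ge] borel_measurable_translates[OF a \<kappa> g0]
    show "(\<lambda>z. translates a \<kappa> (\<lambda>z. zero_ext g z \<bullet> e) z * \<phi> z) \<in> borel_measurable lborel" by measurable
    show "(\<lambda>z. (translates a \<kappa> (zero_ext g) z \<bullet> e) * \<phi> z) \<in> borel_measurable lborel" by measurable
    show "AE z in lborel. translates a \<kappa> (\<lambda>z. zero_ext g z \<bullet> e) z * \<phi> z = (translates a \<kappa> (zero_ext g) z \<bullet> e) * \<phi> z"
      using translates_inner[OF a \<kappa> g0, of e] by eventually_elim simp
  qed
  finally show "(LINT z|lborel. translates a \<kappa> (zero_ext u) z * frechet_derivative \<phi> (at z) e) =
      - (LINT z|lborel. (translates a \<kappa> (zero_ext g) z \<bullet> e) * \<phi> z)" .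
qed

text \<open>The segment runs backwards from \<open>z\<close> because forward averages of
  \<open>u\<close> become backward averages of the test function under the adjoint relation.\<close>

lemma integral_directional_derivative:
  fixes f :: "'a::euclidean_space \<Rightarrow> real"
  assumes f: "\<And>z. (f has_derivative f' z) (at z)" and cont: "continuous_on UNIV (\<lambda>z. f' z d)" and "t \<ge> 0"
  shows "(LINT s|lborel. indicator {0..t} s * f' (z - s *\<^sub>R d) d) = f z - f (z - t *\<^sub>R d)"
proof -
  have "(LINT s|lborel. indicator {0..t} s *\<^sub>R f' (z - s *\<^sub>R d) d) =
      - f (z - t *\<^sub>R d) - (- f (z - 0 *\<^sub>R d))"
  proof (rule integral_FTC_Icc)
    fix s
    have "linear (f' (z - s *\<^sub>R d))"
      by (rule has_derivative_linear[OF f])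
    then have lin: "f' (z - s *\<^sub>R d) (- (h *\<^sub>R d)) = - h * f' (z - s *\<^sub>R d) d" for h
      by (simp add: linear_neg linear_scale)
    have "((\<lambda>s. z - s *\<^sub>R d) has_derivative (\<lambda>h. - (h *\<^sub>R d))) (at s)"
      by (auto intro!: derivative_eq_intros)
    from has_derivative_minus[OF has_derivative_compose[OF this f]]
    have "((\<lambda>s. - f (z - s *\<^sub>R d)) has_vector_derivative f' (z - s *\<^sub>R d) d) (at s)"
      unfolding has_vector_derivative_def lin by simp
    then show "((\<lambda>s. - f (z - s *\<^sub>R d)) has_vector_derivative f' (z - s *\<^sub>R d) d) (at s within {0..t})"
      by (rule has_vector_derivative_at_within)
  next
    show "continuous_on {0..t} (\<lambda>s. f' (z - s *\<^sub>R d) d)"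
      by (rule continuous_on_compose2[OF cont]) (auto intro!: continuous_intros)
  qed fact
  then show ?thesis by simp
qed

text \<open>The fundamental theorem of calculus along lines, by duality instead of absolute
  continuity on lines. Paired with \<open>\<phi>\<close>, the line integral of \<open>g\<close>
  turns into minus the integral of \<open>u\<close> times the backward line integral of
  \<partial>\<phi>, which is \<open>\<phi> z - \<phi> (z - t *\<^sub>R d)\<close>; shifting back
  gives the increment of \<open>u\<close>. The exceptional null set may depend on
  \<open>t\<close>.\<close>

lemma W11_increment:
  fixes u :: "(real^'n) \<times> real \<Rightarrow> real"
  assumes u: "set_integrable lborel half_space u" and g: "L1_weak_gradient u g"
    and d: "d \<in> Basis" "snd d \<ge> 0" and t: "t \<ge> 0"
  shows "AE z in lborel. z \<in> half_space \<longrightarrow>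
    u (z + t *\<^sub>R d) - u z = translates (\<lambda>s. s *\<^sub>R d) (indicator {0..t}) (\<lambda>z. zero_ext g z \<bullet> d) z"
proof -
  let ?a = "\<lambda>s::real. s *\<^sub>R d" and ?\<kappa> = "indicator {0..t} :: real \<Rightarrow> real"
  let ?G = "translates ?a ?\<kappa> (\<lambda>z. zero_ext g z \<bullet> d)"
  have u0: "integrable lborel (zero_ext u)" using u by (simp add: integrable_zero_ext_iff)
  have gd: "integrable lborel (\<lambda>z. zero_ext g z \<bullet> d)" using L1_weak_gradientD(1)[OF g] by simp
  have a: "?a \<in> borel_measurable borel" by measurable
  have \<kappa>: "integrable lborel ?\<kappa>" by (rule integrable_real_indicator) (auto simp: emeasure_lborel_Icc_eq)
  have G: "integrable lborel ?G" by (rule integrable_translates[OF a \<kappa> gd])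
  have ut: "integrable lborel (\<lambda>z. zero_ext u (z + t *\<^sub>R d))" by (rule lborel_integrable_translate[OF u0])
  have up: "snd (?a s) \<ge> 0" if "?\<kappa> s \<noteq> 0" for s
    using that d by (auto simp: indicator_def split: if_splits)
  have "AE z in lborel. z \<in> half_space \<longrightarrow> zero_ext u (z + t *\<^sub>R d) - zero_ext u z - ?G z = 0"
  proof (rule test_function_integrals_zero_imp_AE_zero[OF _ open_half_space])
    have "integrable lborel (\<lambda>z. zero_ext u (z + t *\<^sub>R d) - zero_ext u z - ?G z)" using u0 ut G by simp
    then show "set_integrable lborel half_space (\<lambda>z. zero_ext u (z + t *\<^sub>R d) - zero_ext u z - ?G z)"
      unfolding set_integrable_def by (intro integrable_mult_indicator) auto
    fix \<phi> :: "(real^'n) \<times> real \<Rightarrow> real" assume \<phi>: "test_function half_space \<phi>"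
    note [measurable] = test_function_borel_measurable[OF \<phi>] borel_measurable_integrable[OF u0]
    obtain B where B: "\<And>z. \<bar>\<phi> z\<bar> \<le> B" using test_function_bounded[OF \<phi>] by blast
    obtain C where C: "\<And>z. \<bar>frechet_derivative \<phi> (at z) d\<bar> \<le> C"
      using test_function_derivative_bounded[OF \<phi>] by blast
    have "(LINT z|lborel. ?G z * \<phi> z) = (LINT s|lborel. ?\<kappa> s * (LINT z|lborel. (zero_ext g z \<bullet> d) * \<phi> (z - ?a s)))"
      by (rule integral_translates_mult(1)[OF a \<kappa> gd _ B]) measurable
    also have "\<dots> = (LINT s|lborel. - (?\<kappa> s * (LINT z|lborel. zero_ext u z * frechet_derivative \<phi> (at (z - ?a s)) d)))"
    proof (rule Bochner_Integration.integral_cong[OF refl])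
      fix s
      show "?\<kappa> s * (LINT z|lborel. (zero_ext g z \<bullet> d) * \<phi> (z - ?a s)) =
        - (?\<kappa> s * (LINT z|lborel. zero_ext u z * frechet_derivative \<phi> (at (z - ?a s)) d))"
      proof (cases "?\<kappa> s = 0")
        case False
        have "test_function half_space (\<lambda>z. \<phi> (z - ?a s))"
          using up[OF False] by (intro test_function_translate \<phi>) (auto simp: mem_half_space_iff)
        from L1_weak_gradientD(2)[OF g this d(1)] show ?thesis
          by (simp add: frechet_derivative_translate[OF \<phi>])
      qed simp
    qed
    also have "\<dots> = - (LINT z|lborel. translates ?a ?\<kappa> (zero_ext u) z * frechet_derivative \<phi> (at z) d)"
      by (subst integral_translates_mult(1)[OF a \<kappa> u0 test_function_borel_measurable(2)[OF \<phi>] C]) simp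
    \<comment> \<open>Here the integration along the segment passes from \<open>u\<close> to the
      smooth factor, where it can be carried out exactly.\<close>
    also have "\<dots> = - (LINT z|lborel. zero_ext u z * translates (\<lambda>s. - ?a s) ?\<kappa> (\<lambda>z. frechet_derivative \<phi> (at z) d) z)"
      by (subst integral_translates_mult(2)[OF a \<kappa> u0 test_function_borel_measurable(2)[OF \<phi>] C]) simp
    also have "\<dots> = - (LINT z|lborel. zero_ext u z * (\<phi> z - \<phi> (z - t *\<^sub>R d)))"
      using integral_directional_derivative[OF test_function_has_derivative[OF \<phi>] test_function_derivative_continuous[OF \<phi>] t] by (simp add: translates_def)
    also have "\<dots> = (LINT z|lborel. zero_ext u z * \<phi> (z - t *\<^sub>R d)) - (LINT z|lborel. zero_ext u z * \<phi> z)"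
    proof -
      have "integrable lborel (\<lambda>z. zero_ext u z * \<phi> (z - t *\<^sub>R d))"
        by (rule integrable_mult_bounded[OF u0 _ B]) measurable
      then show ?thesis
        using integrable_mult_test_function(1)[OF u0 \<phi>] by (simp add: right_diff_distrib)
    qed
    also have "(LINT z|lborel. zero_ext u z * \<phi> (z - t *\<^sub>R d)) = (LINT z|lborel. zero_ext u (z + t *\<^sub>R d) * \<phi> z)"
      using lborel_integral_translate[of "\<lambda>z. zero_ext u z * \<phi> (z - t *\<^sub>R d)" "t *\<^sub>R d"] by simp
    finally have "(LINT z|lborel. (zero_ext u (z + t *\<^sub>R d) - zero_ext u z - ?G z) * \<phi> z) = 0"
      using integrable_mult_test_function(1)[OF u0 \<phi>] integrable_mult_test_function(1)[OF ut \<phi>]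
        integrable_mult_test_function(1)[OF G \<phi>]
      by (simp add: left_diff_distrib)
    moreover have "(LINT z:half_space|lborel. (zero_ext u (z + t *\<^sub>R d) - zero_ext u z - ?G z) * \<phi> z) =
        (LINT z|lborel. (zero_ext u (z + t *\<^sub>R d) - zero_ext u z - ?G z) * \<phi> z)"
      unfolding set_lebesgue_integral_def using test_function_outside[OF \<phi>]
      by (auto intro!: Bochner_Integration.integral_cong simp: indicator_def)
    ultimately show "(LINT z:half_space|lborel. (zero_ext u (z + t *\<^sub>R d) - zero_ext u z - ?G z) * \<phi> z) = 0"
      by simp
  qed
  then show ?thesis
  proof (rule eventually_mono, intro impI)
    fix z assume *: "z \<in> half_space \<longrightarrow> zero_ext u (z + t *\<^sub>R d) - zero_ext u z - ?G z = 0" and z: "z \<in> half_space"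
    have "z + t *\<^sub>R d \<in> half_space" using z d t by (auto simp: mem_half_space_iff intro!: add_pos_nonneg)
    with * z show "u (z + t *\<^sub>R d) - u z = ?G z" by simp
  qed
qed

section \<open>The trace inequality\<close>

text \<open>After a substitution the fixed function |u| is integrated over \<open>S\<close> moved by
  \<open>k\<close> in direction \<open>e\<close>. By \<open>esc\<close> each point eventually lies
  outside the moved sets, and |u| dominates.\<close>

lemma integral_escaping_set_tendsto_0:
  fixes u :: "'a::euclidean_space \<Rightarrow> real"
  assumes u: "integrable lborel u" and [measurable]: "S \<in> sets borel"
    and esc: "\<And>z. \<forall>\<^sub>F k in sequentially. z - real k *\<^sub>R e \<notin> S"
  shows "(\<lambda>k. LINT z|lborel. \<bar>u (z + real k *\<^sub>R e)\<bar> * indicator S z) \<longlonglongrightarrow> 0"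
proof -
  note [measurable] = borel_measurable_integrable[OF u]
  have "(\<lambda>k. LINT z|lborel. \<bar>u z\<bar> * indicator S (z - real k *\<^sub>R e)) \<longlonglongrightarrow> (LINT z|(lborel :: 'a measure). (0::real))"
  proof (rule integral_dominated_convergence[where w = "\<lambda>z. \<bar>u z\<bar>"])
    show "AE z in lborel. (\<lambda>k. \<bar>u z\<bar> * indicator S (z - real k *\<^sub>R e)) \<longlonglongrightarrow> 0"
    proof (rule AE_I2, rule tendsto_eventually)
      fix z :: 'a
      show "\<forall>\<^sub>F k in sequentially. \<bar>u z\<bar> * indicator S (z - real k *\<^sub>R e) = 0"
        by (rule eventually_mono[OF esc[of z]]) simp
    qed
  qed (use u in \<open>auto simp: indicator_def\<close>)
  moreover have "(LINT z|lborel. \<bar>u (z + real k *\<^sub>R e)\<bar> * indicator S z) =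
      (LINT z|lborel. \<bar>u z\<bar> * indicator S (z - real k *\<^sub>R e))" for k
    using lborel_integral_translate[of "\<lambda>z. \<bar>u z\<bar> * indicator S (z - real k *\<^sub>R e)" "real k *\<^sub>R e"] by simp
  ultimately show ?thesis by simp
qed

lemma zero_ext_norm_diff: "norm (zero_ext u z - zero_ext v z) = indicator half_space z *\<^sub>R norm (u z - v z)"
  by (auto simp: zero_ext_def indicator_def)

lemma set_L1_dist:
  "(LINT z:half_space|lborel. norm (u z - v z)) = (LINT z|lborel. norm (zero_ext u z - zero_ext v z))"
  by (simp add: zero_ext_norm_diff set_lebesgue_integral_def)

text \<open>At each point of the slab |u| is at most its value \<open>k\<close> higher up plus the
  integral of |\<partial>u/\<partial>y| on the way. The first term disappears as \<open>k\<close>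
  grows; the second yields the factor \<delta> because a vertical line meets the slab in length
  \<delta>.\<close>

lemma slab_integral_le:
  fixes u :: "(real^'n) \<times> real \<Rightarrow> real"
  assumes u: "set_integrable lborel half_space u" and g: "L1_weak_gradient u g" and \<delta>: "\<delta> > 0"
  shows "(LINT z|lborel. \<bar>zero_ext u z\<bar> * indicator {z. 0 < snd z \<and> snd z < \<delta>} z) \<le>
    \<delta> * (LINT z|lborel. \<bar>snd (zero_ext g z)\<bar>)"
proof -
  let ?S = "{z :: (real^'n) \<times> real. 0 < snd z \<and> snd z < \<delta>}" and ?e = "(0, 1) :: (real^'n) \<times> real"
  have S [measurable]: "?S \<in> sets borel"
    by (intro borel_open open_Collect_conj open_Collect_less continuous_intros)
  have u0: "integrable lborel (zero_ext u)" using u by (simp add: integrable_zero_ext_iff)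
  have h: "integrable lborel (\<lambda>z. \<bar>snd (zero_ext g z)\<bar>)" using L1_weak_gradientD(1)[OF g] by simp
  note [measurable] = borel_measurable_integrable[OF u0] borel_measurable_integrable[OF h]
  let ?a = "\<lambda>s. s *\<^sub>R ?e"
  have step: "(LINT z|lborel. \<bar>zero_ext u z\<bar> * indicator ?S z) \<le>
      (LINT z|lborel. \<bar>zero_ext u (z + real k *\<^sub>R ?e)\<bar> * indicator ?S z) + \<delta> * (LINT z|lborel. \<bar>snd (zero_ext g z)\<bar>)" for k
  proof -
    let ?\<kappa> = "indicator {0..real k} :: real \<Rightarrow> real"
    let ?T = "translates ?a ?\<kappa> (\<lambda>z. \<bar>snd (zero_ext g z)\<bar>)"
    have a: "?a \<in> borel_measurable borel" by measurable
    have \<kappa>: "integrable lborel ?\<kappa>" by (rule integrable_real_indicator) (auto simp: emeasure_lborel_Icc_eq)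
    have T: "integrable lborel ?T" by (rule integrable_translates[OF a \<kappa> h])
    have uk: "integrable lborel (\<lambda>z. zero_ext u (z + real k *\<^sub>R ?e))" by (rule lborel_integrable_translate[OF u0])
    have i1: "integrable lborel (\<lambda>z. \<bar>f z\<bar> * indicator ?S z)" if "integrable lborel f" for f :: "(real^'n) \<times> real \<Rightarrow> real"
      by (rule integrable_mult_bounded[OF _ borel_measurable_indicator, where B = 1])
        (use that S in \<open>auto split: split_indicator\<close>)
    have inc: "AE z in lborel. z \<in> half_space \<longrightarrow>
        u (z + real k *\<^sub>R ?e) - u z = translates ?a ?\<kappa> (\<lambda>z. zero_ext g z \<bullet> ?e) z"
      by (rule W11_increment[OF u g]) (auto simp: Basis_prod_def)
    have "(LINT z|lborel. \<bar>zero_ext u z\<bar> * indicator ?S z) \<le>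
        (LINT z|lborel. \<bar>zero_ext u (z + real k *\<^sub>R ?e)\<bar> * indicator ?S z + \<bar>?T z\<bar> * indicator ?S z)"
    proof (rule integral_mono_AE)
      show "AE z in lborel. \<bar>zero_ext u z\<bar> * indicator ?S z \<le>
        \<bar>zero_ext u (z + real k *\<^sub>R ?e)\<bar> * indicator ?S z + \<bar>?T z\<bar> * indicator ?S z"
        using inc
      proof eventually_elim
        case (elim z)
        show ?case
        proof (cases "z \<in> ?S")
          case True
          then have z: "z \<in> half_space" "z + real k *\<^sub>R ?e \<in> half_space"
            by (auto simp: mem_half_space_iff)
          have "\<bar>translates ?a ?\<kappa> (\<lambda>z. zero_ext g z \<bullet> ?e) z\<bar> \<le> ?T z"
            using integral_norm_bound[of lborel "\<lambda>s. ?\<kappa> s *\<^sub>R (zero_ext g (z + ?a s) \<bullet> ?e)"]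
            by (simp add: translates_def inner_prod_def abs_mult)
          with elim z show ?thesis using True by simp
        qed simp
      qed
    qed (intro Bochner_Integration.integrable_add i1 u0 uk T)+
    also have "\<dots> = (LINT z|lborel. \<bar>zero_ext u (z + real k *\<^sub>R ?e)\<bar> * indicator ?S z) + (LINT z|lborel. \<bar>?T z\<bar> * indicator ?S z)"
      by (intro Bochner_Integration.integral_add i1 uk T)
    also have "(LINT z|lborel. \<bar>?T z\<bar> * indicator ?S z) = (LINT z|lborel. ?T z * indicator ?S z)"
      by (intro Bochner_Integration.integral_cong refl arg_cong2[where f = "(*)"] abs_of_nonneg)
         (auto simp: translates_def intro!: integral_nonneg_AE)
    also have "\<dots> = (LINT z|lborel. \<bar>snd (zero_ext g z)\<bar> * translates (\<lambda>s. - ?a s) ?\<kappa> (indicator ?S) z)"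
      by (rule integral_translates_mult(2)[OF a \<kappa> h, where B = 1]) (use S in \<open>auto split: split_indicator\<close>)
    also have "\<dots> \<le> (LINT z|lborel. \<delta> * \<bar>snd (zero_ext g z)\<bar>)"
    proof (rule Bochner_Integration.integral_mono')
      show "integrable lborel (\<lambda>z. \<delta> * \<bar>snd (zero_ext g z)\<bar>)" using h by simp
      fix z :: "(real^'n) \<times> real"
      \<comment> \<open>For fixed \<open>z\<close> this is the measure of those \<open>s\<close> in
        \<open>{0..real k}\<close> for which the point \<open>s\<close> below \<open>z\<close> lies
        in the slab, that is, \<open>snd z - \<delta> < s < snd z\<close>.\<close>
      have "translates (\<lambda>s. - ?a s) ?\<kappa> (indicator ?S) z \<le> (LINT s|lborel. indicat_real {snd z - \<delta><..<snd z} s)"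
        unfolding translates_def
      proof (rule Bochner_Integration.integral_mono')
        show "integrable lborel (\<lambda>s. indicat_real {snd z - \<delta><..<snd z} s)"
          using \<delta> by (intro integrable_real_indicator) (auto simp: emeasure_lborel_Ioo)
      qed (auto simp: indicator_def)
      also have "\<dots> = \<delta>" using \<delta> by simp
      finally show "\<bar>snd (zero_ext g z)\<bar> * translates (\<lambda>s. - ?a s) ?\<kappa> (indicator ?S) z \<le> \<delta> * \<bar>snd (zero_ext g z)\<bar>"
        using mult_left_mono[of _ \<delta> "\<bar>snd (zero_ext g z)\<bar>"] by (simp only: mult.commute[of \<delta>] abs_ge_zero)
    qed (use \<delta> in auto)
    finally show ?thesis by simp
  qed
  have esc: "\<forall>\<^sub>F k in sequentially. z - real k *\<^sub>R ?e \<notin> ?S" for z :: "(real^'n) \<times> real"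
  proof -
    obtain m where m: "snd z \<le> real m" using real_arch_simple by blast
    show ?thesis
      by (rule eventually_mono[OF eventually_ge_at_top[of m]]) (use m in auto)
  qed
  show ?thesis
  proof (rule LIMSEQ_le_const)
    show "(\<lambda>k. (LINT z|lborel. \<bar>zero_ext u (z + real k *\<^sub>R ?e)\<bar> * indicator ?S z) + \<delta> * (LINT z|lborel. \<bar>snd (zero_ext g z)\<bar>))
        \<longlonglongrightarrow> \<delta> * (LINT z|lborel. \<bar>snd (zero_ext g z)\<bar>)"
      using tendsto_add[OF integral_escaping_set_tendsto_0[OF u0 S esc] tendsto_const] by simp
  qed (use step in auto)
qed

text \<open>By the slab bound, the mean over heights \<open>0 < y < \<delta>\<close> of the integral
  of |u(x, y)| is at most \<open>?C\<close>, so some height stays below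
  \<open>?C + \<delta>\<close>. Such heights can be chosen tending to 0, and continuity with Fatou's
  lemma gives the boundary value. The left side is a nonnegative integral because integrability of
  \<open>u (x, 0)\<close> is part of what is proved.\<close>

lemma trace_inequality:
  fixes u :: "(real^'n) \<times> real \<Rightarrow> real"
  assumes u: "set_integrable lborel half_space u" and g: "L1_weak_gradient u g"
    and cont: "continuous_on closed_half_space u"
  shows "(\<integral>\<^sup>+x. ennreal \<bar>u (x, 0)\<bar> \<partial>lborel) \<le> ennreal (LINT z|lborel. \<bar>snd (zero_ext g z)\<bar>)"
proof -
  let ?C = "LINT z|lborel. \<bar>snd (zero_ext g z)\<bar>" and ?\<Phi> = "\<lambda>y. \<integral>\<^sup>+x. ennreal \<bar>u (x, y)\<bar> \<partial>lborel"
  have u0: "integrable lborel (zero_ext u)" using u by (simp add: integrable_zero_ext_iff)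
  note [measurable] = borel_measurable_integrable[OF u0]
  have C: "?C \<ge> 0" by simp
  have cx: "continuous_on UNIV (\<lambda>x. u (x, y))" if "y \<ge> 0" for y
    by (rule continuous_on_compose2[OF cont]) (use that in \<open>auto intro!: continuous_intros simp: closed_half_space_def\<close>)
  \<comment> \<open>The slack \<delta> makes the contradiction strict: otherwise the slab would
    carry mass at least \<open>\<delta> * (?C + \<delta>)\<close>, above the bound
    \<open>\<delta> * ?C\<close>.\<close>
  have "\<exists>y. 0 < y \<and> y < \<delta> \<and> ?\<Phi> y < ennreal (?C + \<delta>)" if \<delta>: "\<delta> > 0" for \<delta> :: real
  proof (rule ccontr)
    assume no: "\<not> ?thesis"
    let ?S = "{z :: (real^'n) \<times> real. 0 < snd z \<and> snd z < \<delta>}"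
    have S [measurable]: "?S \<in> sets borel"
      by (intro borel_open open_Collect_conj open_Collect_less continuous_intros)
    let ?f = "\<lambda>z. \<bar>zero_ext u z\<bar> * indicator ?S z"
    have f: "integrable lborel ?f"
      by (rule integrable_mult_bounded[OF _ borel_measurable_indicator, where B = 1])
        (use u0 S in \<open>auto split: split_indicator\<close>)
    have fm: "(\<lambda>z. ennreal (?f z)) \<in> borel_measurable (lborel \<Otimes>\<^sub>M lborel)"
      unfolding lborel_prod by measurable
    have "ennreal (\<delta> * (?C + \<delta>)) = (\<integral>\<^sup>+y. ennreal (?C + \<delta>) * indicator {0<..<\<delta>} y \<partial>lborel)"
      using \<delta> C by (subst nn_integral_cmult_indicator)
        (auto simp: mult.commute ennreal_mult simp flip: ennreal_plus)
    also have "\<dots> \<le> (\<integral>\<^sup>+y. (\<integral>\<^sup>+x. ennreal (?f (x, y)) \<partial>lborel) \<partial>lborel)"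
    proof (rule nn_integral_mono)
      fix y :: real
      show "ennreal (?C + \<delta>) * indicator {0<..<\<delta>} y \<le> (\<integral>\<^sup>+x. ennreal (?f (x, y)) \<partial>lborel)"
      proof (cases "0 < y \<and> y < \<delta>")
        case True
        then have "?f (x, y) = \<bar>u (x, y)\<bar>" for x by simp
        moreover have "ennreal (?C + \<delta>) \<le> ?\<Phi> y" using no True by (meson not_le)
        ultimately show ?thesis using True by simp
      qed auto
    qed
    also have "\<dots> = (\<integral>\<^sup>+z. ennreal (?f z) \<partial>(lborel \<Otimes>\<^sub>M lborel))"
      by (rule lborel_pair.nn_integral_snd[OF fm])
    also have "\<dots> = ennreal (LINT z|lborel. ?f z)"
      unfolding lborel_prod using f by (intro nn_integral_eq_integral) auto
    also have "\<dots> \<le> ennreal (\<delta> * ?C)"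
      by (intro ennreal_leI slab_integral_le[OF u g \<delta>])
    finally have "\<delta> * (?C + \<delta>) \<le> \<delta> * ?C" using \<delta> C by (simp add: ennreal_le_iff)
    with \<delta> show False by (simp add: distrib_left mult_le_0_iff)
  qed
  then have "\<exists>y. 0 < y \<and> y < inverse (real (Suc k)) \<and> ?\<Phi> y < ennreal (?C + inverse (real (Suc k)))" for k
    by simp
  then obtain Y where Y: "\<And>k. 0 < Y k" "\<And>k. Y k < inverse (real (Suc k))"
      "\<And>k. ?\<Phi> (Y k) < ennreal (?C + inverse (real (Suc k)))" by metis
  have Y0: "Y \<longlonglongrightarrow> 0"
    by (rule tendsto_sandwich[OF _ _ tendsto_const LIMSEQ_inverse_real_of_nat])
       (use Y in \<open>auto intro!: always_eventually less_imp_le\<close>)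
  have "(\<lambda>k. u (x, Y k)) \<longlonglongrightarrow> u (x, 0)" for x
    by (rule continuous_on_tendsto_compose[OF cont])
       (use Y in \<open>auto intro!: tendsto_Pair Y0 always_eventually less_imp_le simp: closed_half_space_def\<close>)
  then have "(\<lambda>k. ennreal \<bar>u (x, Y k)\<bar>) \<longlonglongrightarrow> ennreal \<bar>u (x, 0)\<bar>" for x
    by (intro tendsto_ennrealI tendsto_rabs)
  then have "(\<integral>\<^sup>+x. ennreal \<bar>u (x, 0)\<bar> \<partial>lborel) = (\<integral>\<^sup>+x. liminf (\<lambda>k. ennreal \<bar>u (x, Y k)\<bar>) \<partial>lborel)"
    by (intro nn_integral_cong lim_imp_Liminf[symmetric]) auto
  also have "\<dots> \<le> liminf (\<lambda>k. ?\<Phi> (Y k))"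
  proof (rule nn_integral_liminf)
    fix k
    have [measurable]: "(\<lambda>x. u (x, Y k)) \<in> borel_measurable borel"
      by (rule borel_measurable_continuous_onI[OF cx]) (use Y(1)[of k] in simp)
    show "(\<lambda>x. ennreal \<bar>u (x, Y k)\<bar>) \<in> borel_measurable lborel" by measurable
  qed
  also have "\<dots> \<le> liminf (\<lambda>k. ennreal (?C + inverse (real (Suc k))))"
    by (intro Liminf_mono always_eventually allI less_imp_le Y)
  also have "\<dots> = ennreal ?C"
  proof (rule lim_imp_Liminf)
    show "(\<lambda>k. ennreal (?C + inverse (real (Suc k)))) \<longlonglongrightarrow> ennreal ?C"
      using tendsto_add[OF tendsto_const LIMSEQ_inverse_real_of_nat] by (intro tendsto_ennrealI) simp
  qed simp
  finally show ?thesis .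
qed

text \<open>The trace inequality for differences of continuous approximants, passed to the limit;
  the gradient errors enter additively and vanish. With \<open>v = u\<close> it yields uniqueness of
  the trace, with \<open>v = 0\<close> the bound on its L1 norm.\<close>

lemma has_trace_diff_le:
  fixes u v :: "(real^'n) \<times> real \<Rightarrow> real"
  assumes u: "u \<in> W11" "has_trace u f" and v: "v \<in> W11" "has_trace v h"
  shows "(\<integral>\<^sup>+x. ennreal \<bar>f x - h x\<bar> \<partial>lborel) \<le>
    ennreal (LINT z|lborel. \<bar>snd (zero_ext (weak_grad u) z - zero_ext (weak_grad v) z)\<bar>)"
proof -
  let ?G = "\<lambda>u z. zero_ext (weak_grad u) z"
  let ?D = "LINT z|lborel. \<bar>snd (?G u z - ?G v z)\<bar>"
  obtain U where U: "\<And>k. U k \<in> W11" "\<And>k. continuous_on closed_half_space (U k)"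
      "(\<lambda>k. LINT z|lborel. norm (?G (U k) z - ?G u z)) \<longlonglongrightarrow> 0"
      "(\<lambda>k. \<integral>\<^sup>+x. ennreal \<bar>U k (x, 0) - f x\<bar> \<partial>lborel) \<longlonglongrightarrow> 0" and f: "integrable lborel f"
    using u(2) unfolding has_trace_def set_L1_dist by blast
  obtain V where V: "\<And>k. V k \<in> W11" "\<And>k. continuous_on closed_half_space (V k)"
      "(\<lambda>k. LINT z|lborel. norm (?G (V k) z - ?G v z)) \<longlonglongrightarrow> 0"
      "(\<lambda>k. \<integral>\<^sup>+x. ennreal \<bar>V k (x, 0) - h x\<bar> \<partial>lborel) \<longlonglongrightarrow> 0" and h: "integrable lborel h"
    using v(2) unfolding has_trace_def set_L1_dist by blast
  note [measurable] = borel_measurable_integrable[OF f] borel_measurable_integrable[OF h]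
  note int = W11_zero_ext_integrable(2)
  have cx: "(\<lambda>x. w (x, 0)) \<in> borel_measurable borel" if "continuous_on closed_half_space w" for w :: "(real^'n) \<times> real \<Rightarrow> real"
    by (rule borel_measurable_continuous_onI, rule continuous_on_compose2[OF that])
       (auto intro!: continuous_intros simp: closed_half_space_def)
  note [measurable] = cx[OF U(2)] cx[OF V(2)]
  let ?R = "\<lambda>k. (\<integral>\<^sup>+x. ennreal \<bar>U k (x, 0) - f x\<bar> \<partial>lborel) + (\<integral>\<^sup>+x. ennreal \<bar>V k (x, 0) - h x\<bar> \<partial>lborel) +
    ennreal ((LINT z|lborel. norm (?G (U k) z - ?G u z)) + (LINT z|lborel. norm (?G (V k) z - ?G v z)) + ?D)"
  have "(\<integral>\<^sup>+x. ennreal \<bar>f x - h x\<bar> \<partial>lborel) \<le> ?R k" for k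
  proof -
    have si: "set_integrable lborel half_space (U k)" "set_integrable lborel half_space (V k)"
      using U(1)[of k] V(1)[of k] by (auto simp: W11_def)
    have "(\<integral>\<^sup>+x. ennreal \<bar>U k (x, 0) - V k (x, 0)\<bar> \<partial>lborel) \<le>
        ennreal (LINT z|lborel. \<bar>snd (zero_ext (\<lambda>z. weak_grad (U k) z - weak_grad (V k) z) z)\<bar>)"
    proof (rule trace_inequality)
      show "L1_weak_gradient (\<lambda>z. U k z - V k z) (\<lambda>z. weak_grad (U k) z - weak_grad (V k) z)"
        by (intro L1_weak_gradient_diff si W11_weak_grad U V)
      show "set_integrable lborel half_space (\<lambda>z. U k z - V k z)" using si by simp
      show "continuous_on closed_half_space (\<lambda>z. U k z - V k z)" by (intro continuous_on_diff U V)
    qed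
    also have "zero_ext (\<lambda>z. weak_grad (U k) z - weak_grad (V k) z) = (\<lambda>z. ?G (U k) z - ?G (V k) z)"
      by (auto simp: zero_ext_def scaleR_diff_right)
    also have "(LINT z|lborel. \<bar>snd (?G (U k) z - ?G (V k) z)\<bar>) \<le>
        (LINT z|lborel. norm (?G (U k) z - ?G u z) + norm (?G (V k) z - ?G v z) + \<bar>snd (?G u z - ?G v z)\<bar>)"
    proof (rule integral_mono)
      fix z
      have "\<bar>snd (?G (U k) z - ?G u z)\<bar> \<le> norm (?G (U k) z - ?G u z)"
        "\<bar>snd (?G (V k) z - ?G v z)\<bar> \<le> norm (?G (V k) z - ?G v z)"
        by (metis norm_snd_le prod.collapse real_norm_def)+
      then show "\<bar>snd (?G (U k) z - ?G (V k) z)\<bar> \<le>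
          norm (?G (U k) z - ?G u z) + norm (?G (V k) z - ?G v z) + \<bar>snd (?G u z - ?G v z)\<bar>"
        unfolding snd_diff by linarith
    qed (use int[OF U(1)] int[OF V(1)] int[OF u(1)] int[OF v(1)] in auto)
    also have "\<dots> = (LINT z|lborel. norm (?G (U k) z - ?G u z)) + (LINT z|lborel. norm (?G (V k) z - ?G v z)) + ?D"
      using int[OF U(1)] int[OF V(1)] int[OF u(1)] int[OF v(1)] by simp
    finally have mid: "(\<integral>\<^sup>+x. ennreal \<bar>U k (x, 0) - V k (x, 0)\<bar> \<partial>lborel) \<le>
      ennreal ((LINT z|lborel. norm (?G (U k) z - ?G u z)) + (LINT z|lborel. norm (?G (V k) z - ?G v z)) + ?D)"
      by (simp add: ennreal_leI)
    have "(\<integral>\<^sup>+x. ennreal \<bar>f x - h x\<bar> \<partial>lborel) \<le>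
        (\<integral>\<^sup>+x. ennreal \<bar>U k (x, 0) - f x\<bar> + ennreal \<bar>V k (x, 0) - h x\<bar> + ennreal \<bar>U k (x, 0) - V k (x, 0)\<bar> \<partial>lborel)"
      by (intro nn_integral_mono) (simp flip: ennreal_plus)
    also have "\<dots> = (\<integral>\<^sup>+x. ennreal \<bar>U k (x, 0) - f x\<bar> \<partial>lborel) + (\<integral>\<^sup>+x. ennreal \<bar>V k (x, 0) - h x\<bar> \<partial>lborel) +
        (\<integral>\<^sup>+x. ennreal \<bar>U k (x, 0) - V k (x, 0)\<bar> \<partial>lborel)"
      by (simp add: nn_integral_add)
    finally show ?thesis using mid by (meson add_left_mono order_trans)
  qed
  moreover have "?R \<longlonglongrightarrow> 0 + 0 + ennreal (0 + 0 + ?D)"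
    by (intro tendsto_add U(3,4) V(3,4) tendsto_ennrealI tendsto_const)
  ultimately show ?thesis
    using LIMSEQ_le_const[of ?R "ennreal ?D"] by simp
qed

section \<open>Existence and uniqueness of traces\<close>

lemma W11I: "set_integrable lborel half_space u \<Longrightarrow> L1_weak_gradient u g \<Longrightarrow> u \<in> W11"
  by (auto simp: W11_def)

lemma integrable_imp_set_integrable_half_space:
  fixes u :: "(real^'n) \<times> real \<Rightarrow> 'b::{banach, second_countable_topology}"
  shows "integrable lborel u \<Longrightarrow> set_integrable lborel half_space u"
  unfolding set_integrable_def by (intro integrable_mult_indicator) auto

lemma W11_continuous_approximation:
  fixes u :: "(real^'n) \<times> real \<Rightarrow> real"
  assumes u: "u \<in> W11" and e: "e > 0"
  obtains U G where "integrable lborel U" "integrable lborel G" "L1_weak_gradient U G" "continuous_on UNIV U"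
    "(LINT z|lborel. norm (U z - zero_ext u z)) \<le> e"
    "(LINT z|lborel. norm (G z - zero_ext (weak_grad u) z)) \<le> e"
proof -
  let ?g = "weak_grad u"
  note u0 = W11_zero_ext_integrable(1)[OF u] and g0 = W11_zero_ext_integrable(2)[OF u]
  have "\<forall>\<^sub>F w in at 0. L1_modulus (zero_ext u) w < e \<and> L1_modulus (zero_ext ?g) w < e"
    using order_tendstoD(2)[OF L1_modulus_tendsto_0[OF u0] e] order_tendstoD(2)[OF L1_modulus_tendsto_0[OF g0] e]
    by (rule eventually_conj)
  then obtain d where d: "d > 0" "\<And>w. w \<noteq> 0 \<Longrightarrow> norm w < d \<Longrightarrow> L1_modulus (zero_ext u) w < e \<and> L1_modulus (zero_ext ?g) w < e"
    by (auto simp: eventually_at)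
  \<comment> \<open>The filter \<open>at 0\<close> says nothing about \<open>w = 0\<close>, where
    the modulus is 0.\<close>
  have mod: "L1_modulus (zero_ext u) w \<le> e" "L1_modulus (zero_ext ?g) w \<le> e" if "norm w < d" for w
    using that d(2)[of w] e by (cases "w = 0"; simp add: L1_modulus_def)+
  \<comment> \<open>The side length makes the l1 norm of every point of the cube at most
    \<open>d / 2\<close>, which stays strictly inside the radius.\<close>
  define h where "h = d / (2 * real DIM((real^'n) \<times> real))"
  have h: "h > 0" using d(1) by (simp add: h_def)
  \<comment> \<open>The cube has a corner at 0 instead of being centred there, so all its shifts
    point upwards or along the boundary.\<close>
  define Q where "Q = cbox 0 (h *\<^sub>R One :: (real^'n) \<times> real)"
  have small: "norm w < d" if "w \<in> Q" for w
  proof -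
    have "norm w \<le> (\<Sum>b\<in>Basis. \<bar>w \<bullet> b\<bar>)" by (rule norm_le_l1)
    also have "\<dots> \<le> (\<Sum>b\<in>(Basis :: ((real^'n) \<times> real) set). h)"
      using that by (intro sum_mono) (auto simp: Q_def mem_box)
    also have "\<dots> = d / 2" by (simp add: h_def divide_simps)
    also have "\<dots> < d" using d(1) by simp
    finally show ?thesis .
  qed
  have up: "snd w \<ge> 0" if "w \<in> Q" for w
  proof -
    have "0 \<le> w \<bullet> (0, 1)" using that by (auto simp: Q_def mem_box Basis_prod_def)
    then show ?thesis by (simp add: inner_prod_def)
  qed
  have m: "measure lborel Q > 0"
    using h unfolding Q_def by (subst measure_lborel_cbox_eq) (auto intro!: prod_pos)
  define \<kappa> where "\<kappa> w = indicator Q w / measure lborel Q" for w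
  have Q_fin: "emeasure lborel Q < \<infinity>"
    unfolding Q_def by (rule emeasure_lborel_cbox_finite)
  have [measurable]: "Q \<in> sets borel" by (simp add: Q_def)
  have \<kappa>: "integrable lborel \<kappa>" "\<kappa> \<in> borel_measurable borel"
    using Q_fin by (auto simp: \<kappa>_def[abs_def] intro!: integrable_real_indicator)
  have \<kappa>_nonneg: "\<kappa> w \<ge> 0" for w by (simp add: \<kappa>_def)
  have \<kappa>_1: "(LINT w|lborel. \<kappa> w) = 1" using m by (simp add: \<kappa>_def)
  have \<kappa>_bound: "\<bar>\<kappa> w\<bar> \<le> 1 / measure lborel Q" for w
    by (auto simp: \<kappa>_def indicator_def)
  have \<kappa>_supp: "w \<in> Q" if "\<kappa> w \<noteq> 0" for w
    using that by (auto simp: \<kappa>_def indicator_def split: if_splits)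
  have id: "(\<lambda>w :: (real^'n) \<times> real. w) \<in> borel_measurable borel" by simp
  show ?thesis
  proof (rule that[of "translates (\<lambda>w. w) \<kappa> (zero_ext u)" "translates (\<lambda>w. w) \<kappa> (zero_ext ?g)"])
    show "L1_weak_gradient (translates (\<lambda>w. w) \<kappa> (zero_ext u)) (translates (\<lambda>w. w) \<kappa> (zero_ext ?g))"
      using u by (intro L1_weak_gradient_translates id \<kappa> up \<kappa>_supp W11_weak_grad) (auto simp: W11_def)
    show "continuous_on UNIV (translates (\<lambda>w. w) \<kappa> (zero_ext u))"
      by (rule translates_continuous[OF \<kappa>(2) \<kappa>_bound u0])
    show "(LINT z|lborel. norm (translates (\<lambda>w. w) \<kappa> (zero_ext u) z - zero_ext u z)) \<le> e"
      by (rule translates_L1_distance[OF id \<kappa>(1) \<kappa>_nonneg \<kappa>_1 u0]) (intro mod small \<kappa>_supp)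
    show "(LINT z|lborel. norm (translates (\<lambda>w. w) \<kappa> (zero_ext ?g) z - zero_ext ?g z)) \<le> e"
      by (rule translates_L1_distance[OF id \<kappa>(1) \<kappa>_nonneg \<kappa>_1 g0]) (intro mod small \<kappa>_supp)
  qed (intro integrable_translates id \<kappa> u0 g0)+
qed

text \<open>The trace inequality for differences makes the boundary values of continuous
  approximants Cauchy in L1. An almost everywhere convergent subsequence supplies the limit
  \<open>f\<close>, and Fatou's lemma bounds the distance to \<open>f\<close> for the whole
  sequence.\<close>

lemma has_trace_exists:
  fixes u :: "(real^'n) \<times> real \<Rightarrow> real"
  assumes u: "u \<in> W11"
  shows "\<exists>f. has_trace u f"
proof -
  let ?g = "weak_grad u"
  define P where "P k U G \<longleftrightarrow> integrable lborel U \<and> integrable lborel G \<and> L1_weak_gradient U G \<and>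
    continuous_on UNIV U \<and> (LINT z|lborel. norm (U z - zero_ext u z)) \<le> (1/2)^k \<and>
    (LINT z|lborel. norm (G z - zero_ext ?g z)) \<le> (1/2)^k" for k :: nat and U G
  have "\<exists>U G. P k U G" for k
    unfolding P_def by (rule W11_continuous_approximation[OF u, of "(1/2)^k"]) (simp, blast)
  then have "\<forall>k. \<exists>U. \<exists>G. P k U G" by blast
  from choice[OF this] obtain U where "\<forall>k. \<exists>G. P k (U k) G" by blast
  from choice[OF this] obtain G where P: "\<And>k. P k (U k) (G k)" by blast
  have U: "integrable lborel (U k)" and G: "integrable lborel (G k)"
    and UG: "L1_weak_gradient (U k) (G k)" and cont: "continuous_on UNIV (U k)"
    and Uu: "(LINT z|lborel. norm (U k z - zero_ext u z)) \<le> (1/2)^k"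
    and Gg: "(LINT z|lborel. norm (G k z - zero_ext ?g z)) \<le> (1/2)^k" for k
    using P[of k] by (simp_all only: P_def)
  note u0 = W11_zero_ext_integrable(1)[OF u] and g0 = W11_zero_ext_integrable(2)[OF u]
  have UW: "U k \<in> W11" for k
    by (rule W11I[OF integrable_imp_set_integrable_half_space[OF U] UG])
  have half: "(LINT z:half_space|lborel. norm (v z - w z)) \<le> (LINT z|lborel. norm (v z - zero_ext w z))"
    if "integrable lborel v" "integrable lborel (zero_ext w)"
    for v w :: "(real^'n) \<times> real \<Rightarrow> 'b::{banach, second_countable_topology}"
    unfolding set_lebesgue_integral_def
    using that by (intro Bochner_Integration.integral_mono') (auto simp: indicator_def)
  have cx: "(\<lambda>x. U k (x, 0)) \<in> borel_measurable borel" for k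
    by (rule borel_measurable_continuous_onI, rule continuous_on_compose2[OF cont]) (auto intro!: continuous_intros)
  note [measurable] = cx

  have tr: "(\<integral>\<^sup>+x. ennreal \<bar>U k (x, 0) - U l (x, 0)\<bar> \<partial>lborel) \<le> ennreal ((1/2)^k + (1/2)^l)" for k l
  proof -
    have "(\<integral>\<^sup>+x. ennreal \<bar>U k (x, 0) - U l (x, 0)\<bar> \<partial>lborel) \<le>
        ennreal (LINT z|lborel. \<bar>snd (zero_ext (\<lambda>z. G k z - G l z) z)\<bar>)"
    proof (rule trace_inequality)
      show "L1_weak_gradient (\<lambda>z. U k z - U l z) (\<lambda>z. G k z - G l z)"
        by (intro L1_weak_gradient_diff UG integrable_imp_set_integrable_half_space U)
      show "set_integrable lborel half_space (\<lambda>z. U k z - U l z)"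
        by (intro integrable_imp_set_integrable_half_space Bochner_Integration.integrable_diff U)
      show "continuous_on closed_half_space (\<lambda>z. U k z - U l z)"
        by (intro continuous_on_diff cont[THEN continuous_on_subset] subset_UNIV)
    qed
    also have "(LINT z|lborel. \<bar>snd (zero_ext (\<lambda>z. G k z - G l z) z)\<bar>) \<le>
        (LINT z|lborel. norm (G k z - zero_ext ?g z) + norm (G l z - zero_ext ?g z))"
    proof (rule Bochner_Integration.integral_mono')
      fix z
      have "\<bar>snd (zero_ext (\<lambda>z. G k z - G l z) z)\<bar> \<le> norm (zero_ext (\<lambda>z. G k z - G l z) z)"
        using norm_snd_le[of "snd (zero_ext (\<lambda>z. G k z - G l z) z)" "fst (zero_ext (\<lambda>z. G k z - G l z) z)"] by simp
      also have "\<dots> \<le> norm (G k z - G l z)" by (auto simp: zero_ext_def indicator_def)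
      also have "\<dots> \<le> norm (G k z - zero_ext ?g z) + norm (G l z - zero_ext ?g z)"
        using norm_triangle_ineq4[of "G k z - zero_ext ?g z" "G l z - zero_ext ?g z"] by simp
      finally show "\<bar>snd (zero_ext (\<lambda>z. G k z - G l z) z)\<bar> \<le> norm (G k z - zero_ext ?g z) + norm (G l z - zero_ext ?g z)" .
    qed (use G g0 in auto)
    also have "\<dots> \<le> (1/2)^k + (1/2)^l"
      using G g0 Gg[of k] Gg[of l] by simp
    finally show ?thesis by (simp add: ennreal_leI)
  qed
  have s: "integrable lborel (\<lambda>x. U k (x, 0))" for k
  proof (rule integrableI_bounded)
    have "(\<integral>\<^sup>+x. ennreal (norm (U k (x, 0))) \<partial>lborel) \<le> ennreal (LINT z|lborel. \<bar>snd (zero_ext (G k) z)\<bar>)"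
      unfolding real_norm_def
      by (rule trace_inequality) (intro UG integrable_imp_set_integrable_half_space U cont[THEN continuous_on_subset] subset_UNIV)+
    then show "(\<integral>\<^sup>+x. ennreal (norm (U k (x, 0))) \<partial>lborel) < \<infinity>"
      by (rule le_less_trans) simp
  qed measurable
  have dist: "(LINT x|lborel. norm (U k (x, 0) - U l (x, 0))) \<le> (1/2)^k + (1/2)^l" for k l
  proof -
    have "ennreal (LINT x|lborel. norm (U k (x, 0) - U l (x, 0))) \<le> ennreal ((1/2)^k + (1/2)^l)"
      using tr[of k l] s[of k] s[of l] by (subst nn_integral_eq_integral[symmetric]) auto
    then show ?thesis by (subst (asm) ennreal_le_iff) auto
  qed
  have "\<exists>N. \<forall>i\<ge>N. \<forall>j\<ge>N. (LINT x|lborel. norm (U i (x, 0) - U j (x, 0))) < e" if e: "e > 0" for e :: real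
  proof -
    obtain N where N: "(1/2::real)^N < e / 2" using real_arch_pow_inv[of "e / 2" "1/2"] e by auto
    have "(LINT x|lborel. norm (U i (x, 0) - U j (x, 0))) < e" if "i \<ge> N" "j \<ge> N" for i j
    proof -
      have "(1/2::real)^i \<le> (1/2)^N" "(1/2::real)^j \<le> (1/2)^N" using that by (auto intro!: power_decreasing)
      with N dist[of i j] show ?thesis by linarith
    qed
    then show ?thesis by blast
  qed
  then obtain r where r: "strict_mono r" and r_Cauchy: "AE x in lborel. Cauchy (\<lambda>i. U (r i) (x, 0))"
    using cauchy_L1_AE_cauchy_subseq[of lborel "\<lambda>k x. U k (x, 0)", OF s] by blast
  define f where "f x = lim (\<lambda>i. U (r i) (x, 0))" for x
  have f_lim: "AE x in lborel. (\<lambda>i. U (r i) (x, 0)) \<longlonglongrightarrow> f x"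
    using r_Cauchy by eventually_elim (simp only: f_def Cauchy_convergent_iff convergent_LIMSEQ_iff)
  have [measurable]: "f \<in> borel_measurable borel"
    unfolding f_def[abs_def] by (rule borel_measurable_lim_metric) measurable
  have f_dist: "(\<integral>\<^sup>+x. ennreal \<bar>U k (x, 0) - f x\<bar> \<partial>lborel) \<le> ennreal (2 * (1/2)^k)" for k
  proof -
    have "(\<integral>\<^sup>+x. ennreal \<bar>U k (x, 0) - f x\<bar> \<partial>lborel) =
        (\<integral>\<^sup>+x. liminf (\<lambda>i. ennreal \<bar>U k (x, 0) - U (r i) (x, 0)\<bar>) \<partial>lborel)"
    proof (rule nn_integral_cong_AE)
      show "AE x in lborel. ennreal \<bar>U k (x, 0) - f x\<bar> = liminf (\<lambda>i. ennreal \<bar>U k (x, 0) - U (r i) (x, 0)\<bar>)"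
        using f_lim
      proof eventually_elim
        case (elim x)
        have "(\<lambda>i. ennreal \<bar>U k (x, 0) - U (r i) (x, 0)\<bar>) \<longlonglongrightarrow> ennreal \<bar>U k (x, 0) - f x\<bar>"
          by (intro tendsto_ennrealI tendsto_rabs tendsto_diff tendsto_const elim)
        then show ?case by (intro lim_imp_Liminf[symmetric]) auto
      qed
    qed
    also have "\<dots> \<le> liminf (\<lambda>i. \<integral>\<^sup>+x. ennreal \<bar>U k (x, 0) - U (r i) (x, 0)\<bar> \<partial>lborel)"
      by (rule nn_integral_liminf) measurable
    \<comment> \<open>For \<open>i \<ge> k\<close> also \<open>r i \<ge> k\<close>, so both errors
      are at most \<open>(1/2)^k\<close>.\<close>
    also have "\<dots> \<le> liminf (\<lambda>i. ennreal (2 * (1/2)^k))"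
    proof (rule Liminf_mono, rule eventually_mono[OF eventually_ge_at_top[of k]])
      fix i assume "k \<le> i"
      then have "k \<le> r i" using seq_suble[OF r, of i] by linarith
      then have "(1/2::real)^(r i) \<le> (1/2)^k" by (intro power_decreasing) auto
      then show "(\<integral>\<^sup>+x. ennreal \<bar>U k (x, 0) - U (r i) (x, 0)\<bar> \<partial>lborel) \<le> ennreal (2 * (1/2)^k)"
        by (intro order_trans[OF tr[of k "r i"]] ennreal_leI) simp
    qed
    also have "\<dots> = ennreal (2 * (1/2)^k)" by (simp add: Liminf_const)
    finally show ?thesis .
  qed
  have "integrable lborel (\<lambda>x. U 0 (x, 0) - f x)"
  proof (rule integrableI_bounded)
    show "(\<integral>\<^sup>+x. ennreal (norm (U 0 (x, 0) - f x)) \<partial>lborel) < \<infinity>"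
      unfolding real_norm_def by (rule le_less_trans[OF f_dist]) simp
  qed measurable
  from Bochner_Integration.integrable_diff[OF s[of 0] this] have f: "integrable lborel f" by simp
  have pow: "(\<lambda>k. (1/2::real)^k) \<longlonglongrightarrow> 0" by (rule LIMSEQ_power_zero) simp
  show ?thesis
    unfolding has_trace_def
  proof (intro exI[of _ f] conjI exI[of _ U] allI f UW)
    show "continuous_on closed_half_space (U k)" for k by (rule continuous_on_subset[OF cont]) simp
    show "(\<lambda>k. LINT z:half_space|lborel. \<bar>U k z - u z\<bar>) \<longlonglongrightarrow> 0"
    proof (rule tendsto_sandwich[OF _ _ tendsto_const pow])
      show "\<forall>\<^sub>F k in sequentially. (LINT z:half_space|lborel. \<bar>U k z - u z\<bar>) \<le> (1/2)^k"
        using order_trans[OF half[OF U u0] Uu] by (simp add: always_eventually)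
    qed (auto intro!: always_eventually simp: set_lebesgue_integral_def)
    show "(\<lambda>k. LINT z:half_space|lborel. norm (weak_grad (U k) z - ?g z)) \<longlonglongrightarrow> 0"
    proof (rule tendsto_sandwich[OF _ _ tendsto_const pow])
      \<comment> \<open>\<open>has_trace\<close> refers to the chosen gradient of
        \<open>U k\<close>, while the estimate is known for \<open>G k\<close>; the two agree almost
        everywhere in the half-space.\<close>
      have "(LINT z:half_space|lborel. norm (weak_grad (U k) z - ?g z)) = (LINT z:half_space|lborel. norm (G k z - ?g z))" for k
        unfolding set_L1_dist
      proof (rule integral_cong_AE)
        note [measurable] = borel_measurable_integrable[OF g0] borel_measurable_integrable[OF W11_zero_ext_integrable(2)[OF UW]]
          borel_measurable_integrable[OF L1_weak_gradientD(1)[OF UG]]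
        show "(\<lambda>z. norm (zero_ext (weak_grad (U k)) z - zero_ext ?g z)) \<in> borel_measurable lborel" by measurable
        show "(\<lambda>z. norm (zero_ext (G k) z - zero_ext ?g z)) \<in> borel_measurable lborel" by measurable
        show "AE z in lborel. norm (zero_ext (weak_grad (U k)) z - zero_ext ?g z) = norm (zero_ext (G k) z - zero_ext ?g z)"
          using weak_grad_AE[OF UG[of k]] by eventually_elim (auto simp: zero_ext_def indicator_def)
      qed
      then show "\<forall>\<^sub>F k in sequentially. (LINT z:half_space|lborel. norm (weak_grad (U k) z - ?g z)) \<le> (1/2)^k"
        using order_trans[OF half[OF G g0] Gg] by (simp add: always_eventually)
    qed (auto intro!: always_eventually simp: set_lebesgue_integral_def)
    show "(\<lambda>k. \<integral>\<^sup>+x. ennreal \<bar>U k (x, 0) - f x\<bar> \<partial>lborel) \<longlonglongrightarrow> 0"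
    proof (rule tendsto_sandwich[OF _ _ tendsto_const])
      show "(\<lambda>k. ennreal (2 * (1/2)^k)) \<longlonglongrightarrow> 0"
        using tendsto_ennrealI[OF tendsto_mult_right_zero[OF pow, of 2]] by simp
    qed (use f_dist in \<open>auto intro!: always_eventually\<close>)
  qed
qed

lemma has_trace_boundary_trace: "u \<in> W11 \<Longrightarrow> has_trace u (boundary_trace u)"
  unfolding boundary_trace_def using someI_ex[OF has_trace_exists] .

text \<open>The constant sequence is an admissible approximation.\<close>

lemma has_trace_continuous:
  assumes "u \<in> W11" "continuous_on closed_half_space u" "integrable lborel (\<lambda>x. u (x, 0))"
  shows "has_trace u (\<lambda>x. u (x, 0))"
  unfolding has_trace_def using assms by (intro conjI exI[of _ "\<lambda>_. u"]) (simp_all add: set_lebesgue_integral_def)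

lemma has_trace_unique:
  fixes u :: "(real^'n) \<times> real \<Rightarrow> real"
  assumes "u \<in> W11" "has_trace u f" "has_trace u h"
  shows "AE x in lborel. f x = h x"
proof -
  have "(\<integral>\<^sup>+x. ennreal \<bar>f x - h x\<bar> \<partial>lborel) = 0"
    using has_trace_diff_le[OF assms(1,2,1,3)] by simp
  moreover have "integrable lborel f" "integrable lborel h" using assms by (auto simp: has_trace_def)
  ultimately show ?thesis
    by (subst (asm) nn_integral_0_iff_AE) simp_all
qed

text \<open>Comparison with the zero function, whose trace is 0. Only the vertical derivative
  appears on the right, which is what later forces the horizontal gradient of an extremal function
  to vanish.\<close>

lemma integral_trace_le:
  fixes u :: "(real^'n) \<times> real \<Rightarrow> real"
  assumes u: "u \<in> W11" "has_trace u f"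
  shows "(LINT x|lborel. \<bar>f x\<bar>) \<le> (LINT z|lborel. \<bar>snd (zero_ext (weak_grad u) z)\<bar>)"
proof -
  let ?o = "\<lambda>_ :: (real^'n) \<times> real. 0 :: real"
  have g0: "L1_weak_gradient ?o (\<lambda>_. 0)" by (simp add: L1_weak_gradient_def set_integrable_def)
  have o: "?o \<in> W11" by (rule W11I[OF _ g0]) (simp add: set_integrable_def)
  have t: "has_trace ?o (\<lambda>_. 0)"
    using has_trace_continuous[OF o] by simp
  have f: "integrable lborel f" using u(2) by (simp add: has_trace_def)
  have "ennreal (LINT x|lborel. \<bar>f x\<bar>) = (\<integral>\<^sup>+x. ennreal \<bar>f x - 0\<bar> \<partial>lborel)"
    using f by (simp add: nn_integral_eq_integral)
  also have "\<dots> \<le> ennreal (LINT z|lborel. \<bar>snd (zero_ext (weak_grad u) z - zero_ext (weak_grad ?o) z)\<bar>)"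
    by (rule has_trace_diff_le[OF u o t])
  also have "(LINT z|lborel. \<bar>snd (zero_ext (weak_grad u) z - zero_ext (weak_grad ?o) z)\<bar>) =
      (LINT z|lborel. \<bar>snd (zero_ext (weak_grad u) z)\<bar>)"
  \<comment> \<open>Even the zero function has a chosen weak gradient, known to vanish only almost
    everywhere in the half-space.\<close>
  proof (rule integral_cong_AE)
    show "(\<lambda>z. \<bar>snd (zero_ext (weak_grad u) z - zero_ext (weak_grad ?o) z)\<bar>) \<in> borel_measurable lborel"
      "(\<lambda>z. \<bar>snd (zero_ext (weak_grad u) z)\<bar>) \<in> borel_measurable lborel"
      using W11_zero_ext_integrable(2)[OF u(1)] W11_zero_ext_integrable(2)[OF o]
      by (intro borel_measurable_integrable; simp)+
    show "AE z in lborel. \<bar>snd (zero_ext (weak_grad u) z - zero_ext (weak_grad ?o) z)\<bar> = \<bar>snd (zero_ext (weak_grad u) z)\<bar>"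
      using weak_grad_AE[OF g0] by eventually_elim (auto simp: zero_ext_def indicator_def)
  qed
  finally show ?thesis by (subst (asm) ennreal_le_iff) auto
qed

section \<open>The infimum is at most 1\<close>

lemma integrable_continuous_compact_support:
  fixes f :: "'a::euclidean_space \<Rightarrow> 'b::euclidean_space"
  assumes f: "continuous_on UNIV f" and K: "compact K" and out: "\<And>z. z \<notin> K \<Longrightarrow> f z = 0"
  shows "integrable lborel f"
proof -
  have "integrable lborel (\<lambda>z. indicator K z *\<^sub>R f z)"
    by (rule borel_integrable_compact[OF K continuous_on_subset[OF f]]) simp
  moreover have "(\<lambda>z. indicator K z *\<^sub>R f z) = f"
    using out by (auto simp: indicator_def fun_eq_iff)
  ultimately show ?thesis by simp
qed

text \<open>Averaging the derivative over a unit segment leaves its integral unchanged and produces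
  \<open>f z - f (z - d)\<close>, which has integral 0 by translation invariance.\<close>

lemma integral_derivative_compact_support_zero:
  fixes f :: "'a::euclidean_space \<Rightarrow> real"
  assumes f: "\<And>z. (f has_derivative f' z) (at z)" and cont: "continuous_on UNIV (\<lambda>z. f' z d)"
    and K: "compact K" and out: "\<And>z. z \<notin> K \<Longrightarrow> f z = 0" "\<And>z. z \<notin> K \<Longrightarrow> f' z d = 0"
  shows "(LINT z|lborel. f' z d) = 0"
proof -
  have "continuous_on UNIV f"
    using f has_derivative_continuous continuous_at_imp_continuous_on by metis
  then have i: "integrable lborel f" by (rule integrable_continuous_compact_support[OF _ K out(1)])
  have i': "integrable lborel (\<lambda>z. f' z d)" by (rule integrable_continuous_compact_support[OF cont K out(2)])
  let ?a = "\<lambda>s::real. - (s *\<^sub>R d)" and ?\<kappa> = "indicator {0..1} :: real \<Rightarrow> real"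
  have a: "?a \<in> borel_measurable borel" by measurable
  have \<kappa>: "integrable lborel ?\<kappa>" by (rule integrable_real_indicator) (auto simp: emeasure_lborel_Icc_eq)
  have "(LINT z|lborel. f' z d) = (LINT s|lborel. ?\<kappa> s * (LINT z|lborel. f' z d * 1))" by simp
  also have "\<dots> = (LINT z|lborel. translates ?a ?\<kappa> (\<lambda>z. f' z d) z * 1)"
    by (rule integral_translates_mult(1)[OF a \<kappa> i', where B = 1, symmetric]) auto
  also have "\<dots> = (LINT z|lborel. f z - f (z - 1 *\<^sub>R d))"
    using integral_directional_derivative[of f f' d 1, OF f cont] by (simp add: translates_def)
  also have "\<dots> = (LINT z|lborel. f z) - (LINT z|lborel. f (z + - d))"
    using i lborel_integrable_translate[OF i, of "- d"] by simp
  also have "\<dots> = 0"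
    using lborel_integral_translate[OF borel_measurable_integrable[OF i, simplified], of "- d"] by simp
  finally show ?thesis .
qed

text \<open>Integration by parts: the derivative of \<open>v z * \<phi> z\<close> has integral 0,
  and \<open>\<phi>\<close> supplies the compact support, so \<open>v\<close> may grow
  arbitrarily.\<close>

lemma L1_weak_gradient_classical:
  fixes v :: "(real^'n) \<times> real \<Rightarrow> real"
  assumes v: "\<And>z. (v has_derivative v' z) (at z)" and cont: "\<And>e. e \<in> Basis \<Longrightarrow> continuous_on UNIV (\<lambda>z. v' z e)"
    and g: "set_integrable lborel half_space g" "\<And>z e. e \<in> Basis \<Longrightarrow> g z \<bullet> e = v' z e"
  shows "L1_weak_gradient v g"
proof (rule L1_weak_gradientI[OF g(1)])
  fix \<phi> :: "(real^'n) \<times> real \<Rightarrow> real" and e :: "(real^'n) \<times> real"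
  assume \<phi>: "test_function half_space \<phi>" and e: "e \<in> Basis"
  let ?K = "closure {z. \<phi> z \<noteq> 0}"
  have K: "compact ?K" using \<phi> by (simp add: test_function_def)
  have out: "\<phi> z = 0" "frechet_derivative \<phi> (at z) e = 0" if "z \<notin> ?K" for z
    using that frechet_derivative_zero_outside[OF that] closure_subset[of "{z. \<phi> z \<noteq> 0}"] by auto
  have cv: "continuous_on UNIV v"
    using v has_derivative_continuous continuous_at_imp_continuous_on by metis
  note c = cv cont[OF e] test_function_continuous[OF \<phi>] test_function_derivative_continuous[OF \<phi>]
  have zero: "v z * frechet_derivative \<phi> (at z) e = 0" "v' z e * \<phi> z = 0" if "z \<notin> ?K" for z
    using out[OF that] by simp_all
  have "(LINT z|lborel. v z * frechet_derivative \<phi> (at z) e + v' z e * \<phi> z) = 0"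
  proof (rule integral_derivative_compact_support_zero[OF _ _ K])
    show "((\<lambda>z. v z * \<phi> z) has_derivative (\<lambda>h. v z * frechet_derivative \<phi> (at z) h + v' z h * \<phi> z)) (at z)" for z
      by (rule has_derivative_mult[OF v test_function_has_derivative[OF \<phi>]])
    show "continuous_on UNIV (\<lambda>z. v z * frechet_derivative \<phi> (at z) e + v' z e * \<phi> z)"
      by (intro continuous_on_add continuous_on_mult c)
    show "v z * \<phi> z = 0" "v z * frechet_derivative \<phi> (at z) e + v' z e * \<phi> z = 0" if "z \<notin> ?K" for z
      using out[OF that] by simp_all
  qed
  moreover have "integrable lborel (\<lambda>z. v z * frechet_derivative \<phi> (at z) e)"
    by (rule integrable_continuous_compact_support[OF continuous_on_mult[OF c(1,4)] K zero(1)])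
  moreover have "integrable lborel (\<lambda>z. v' z e * \<phi> z)"
    by (rule integrable_continuous_compact_support[OF continuous_on_mult[OF c(2,3)] K zero(2)])
  ultimately show "(LINT z|lborel. v z * frechet_derivative \<phi> (at z) e) = - (LINT z|lborel. (g z \<bullet> e) * \<phi> z)"
    using g(2)[OF e] by simp
qed

section \<open>Product functions and the test profile\<close>

lemma integrable_Pair:
  fixes f :: "'a \<Rightarrow> 'b::{banach, second_countable_topology}" and g :: "'a \<Rightarrow> 'c::{banach, second_countable_topology}"
  assumes "integrable M f" "integrable M g"
  shows "integrable M (\<lambda>x. (f x, g x))"
proof -
  have "integrable M (\<lambda>x. (f x, 0 :: 'c))" "integrable M (\<lambda>x. (0 :: 'b, g x))"
    by (rule integrable_bounded_linear[OF bounded_linear_Pair[OF bounded_linear_ident bounded_linear_zero] assms(1)],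
        rule integrable_bounded_linear[OF bounded_linear_Pair[OF bounded_linear_zero bounded_linear_ident] assms(2)])
  from Bochner_Integration.integrable_add[OF this] show ?thesis by simp
qed

lemma has_bochner_integral_product:
  fixes a :: "'a::euclidean_space \<Rightarrow> 'b::{banach, second_countable_topology}" and b :: "'c::euclidean_space \<Rightarrow> real"
  assumes a: "integrable lborel a" and b: "integrable lborel b"
  shows "has_bochner_integral lborel (\<lambda>z. b (snd z) *\<^sub>R a (fst z)) ((LINT y|lborel. b y) *\<^sub>R (LINT x|lborel. a x))"
proof -
  note [measurable] = borel_measurable_integrable[OF a] borel_measurable_integrable[OF b]
  have i: "integrable (lborel \<Otimes>\<^sub>M lborel) (\<lambda>z. b (snd z) *\<^sub>R a (fst z))"
  proof (rule lborel_pair.Fubini_integrable)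
    show "integrable lborel (\<lambda>x. LINT y|lborel. norm (b (snd (x, y)) *\<^sub>R a (fst (x, y))))"
      using a by simp
  qed (use b in auto)
  have "(LINT y|lborel. b y *\<^sub>R a x) = (LINT y|lborel. b y) *\<^sub>R a x" for x
    using b by simp
  then have "(LINT z|(lborel \<Otimes>\<^sub>M lborel). b (snd z) *\<^sub>R a (fst z)) = (LINT x|lborel. (LINT y|lborel. b y) *\<^sub>R a x)"
    using lborel_pair.integral_fst'[OF i] by simp
  also have "\<dots> = (LINT y|lborel. b y) *\<^sub>R (LINT x|lborel. a x)"
    using a by simp
  finally show ?thesis
    using i by (simp add: has_bochner_integral_iff lborel_prod)
qed

lemma has_bochner_integral_exp_decay:
  fixes \<epsilon> :: real
  assumes "\<epsilon> > 0"
  shows "has_bochner_integral lborel (\<lambda>y. indicator {0<..} y * exp (- (y / \<epsilon>))) \<epsilon>"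
proof -
  have "(\<integral>\<^sup>+y. ennreal (exp (- (y / \<epsilon>))) * indicator {0..} y \<partial>lborel) = ennreal (0 - (- \<epsilon> * exp (- (0 / \<epsilon>))))"
  proof (rule nn_integral_FTC_atLeast)
    have "LIM y at_top. y * inverse \<epsilon> :> at_top"
      using assms by (intro filterlim_at_top_mult_tendsto_pos[OF tendsto_const _ filterlim_ident]) simp
    then have "((\<lambda>y. exp (- (y / \<epsilon>))) \<longlongrightarrow> 0) at_top"
      by (intro filterlim_compose[OF exp_at_bot]) (simp add: filterlim_uminus_at_bot divide_inverse)
    from tendsto_mult_right_zero[OF this, of "- \<epsilon>"]
    show "((\<lambda>y. - \<epsilon> * exp (- (y / \<epsilon>))) \<longlongrightarrow> 0) at_top" .
    show "((\<lambda>y. - \<epsilon> * exp (- (y / \<epsilon>))) has_real_derivative exp (- (x / \<epsilon>))) (at x)" for x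
      using assms by (auto intro!: derivative_eq_intros)
  qed auto
  then have "(\<integral>\<^sup>+y. ennreal (exp (- (y / \<epsilon>)) * indicator {0..} y) \<partial>lborel) = ennreal \<epsilon>"
    by (simp add: ennreal_mult' ennreal_indicator)
  then have "has_bochner_integral lborel (\<lambda>y. exp (- (y / \<epsilon>)) * indicator {0..} y) \<epsilon>"
    using assms by (intro has_bochner_integral_nn_integral) auto
  moreover have "AE y in lborel. exp (- (y / \<epsilon>)) * indicator {0..} y = indicator {0<..} y * exp (- (y / \<epsilon>))"
    using AE_lborel_singleton[of "0::real"] by eventually_elim (auto simp: indicator_def)
  ultimately show ?thesis
    by (subst (asm) has_bochner_integral_cong_AE) auto
qed

text \<open>For the profile, |\<nabla>v| is at most (|D| + \<psi>/\<epsilon>) exp(-y/\<epsilon>),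
  and the exponential has integral \<epsilon> over y > 0. The numerator is thus at most \<epsilon> A
  + B, while the trace has L1 norm B.\<close>

lemma W11_nonzero_J_near_1:
  assumes e: "e > 0"
  shows "\<exists>v \<in> (W11_nonzero :: ((real^'n) \<times> real \<Rightarrow> real) set). J v \<le> ereal (1 + e)"
proof -
  define \<psi> :: "real^'n \<Rightarrow> real" where "\<psi> = box_bump (- One) One 1"
  have \<psi>: "test_function UNIV \<psi>" unfolding \<psi>_def by (rule test_function_box_bump) simp
  have K: "compact (closure {x. \<psi> x \<noteq> 0})" using \<psi> by (simp add: test_function_def)
  have out: "\<psi> x = 0" "frechet_derivative \<psi> (at x) b = 0" if "x \<notin> closure {x. \<psi> x \<noteq> 0}" for x b
    using that frechet_derivative_zero_outside[OF that] closure_subset[of "{x. \<psi> x \<noteq> 0}"] by auto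
  have \<psi>_nonneg: "\<psi> x \<ge> 0" for x by (simp add: \<psi>_def box_bump_bounds)
  \<comment> \<open>The classical gradient of \<psi> as a vector, assembled from its directional
    derivatives.\<close>
  define D where "D x = (\<Sum>b\<in>Basis. frechet_derivative \<psi> (at x) b *\<^sub>R b)" for x
  have D: "frechet_derivative \<psi> (at x) h = D x \<bullet> h" for x h
  proof -
    have lin: "linear (frechet_derivative \<psi> (at x))"
      by (rule has_derivative_linear[OF test_function_has_derivative[OF \<psi>]])
    have "frechet_derivative \<psi> (at x) h = frechet_derivative \<psi> (at x) (\<Sum>b\<in>Basis. (h \<bullet> b) *\<^sub>R b)"
      by (simp add: euclidean_representation)
    also have "\<dots> = (\<Sum>b\<in>Basis. (h \<bullet> b) * frechet_derivative \<psi> (at x) b)"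
      by (simp add: linear_sum[OF lin] linear_scale[OF lin])
    also have "\<dots> = D x \<bullet> h"
      by (simp add: D_def inner_sum_right inner_commute[of _ h] mult.commute)
    finally show ?thesis .
  qed
  have \<psi>_int: "integrable lborel \<psi>"
    by (rule integrable_continuous_compact_support[OF test_function_continuous[OF \<psi>] K out(1)])
  have D_cont: "continuous_on UNIV D"
    unfolding D_def by (intro continuous_intros test_function_derivative_continuous[OF \<psi>])
  have D_int: "integrable lborel D"
    by (rule integrable_continuous_compact_support[OF D_cont K]) (simp add: D_def out(2))
  define A where "A = (LINT x|lborel. norm (D x))"
  define B where "B = (LINT x|lborel. \<psi> x)"
  have A: "A \<ge> 0" by (simp add: A_def)
  have B: "B > 0"
  proof -
    \<comment> \<open>The bump is positive on the whole open box, so a zero integral would make that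
      box a null set.\<close>
    have "B \<noteq> 0"
    proof
      assume "B = 0"
      then have "AE x in lborel. \<psi> x = 0"
        using integral_nonneg_eq_0_iff_AE[OF \<psi>_int] \<psi>_nonneg by (simp add: B_def)
      then have "AE x in lborel. x \<notin> box (- One) (One :: real^'n)"
        by (rule eventually_mono) (use box_bump_pos[of _ "- One" "One :: real^'n" 1] in \<open>force simp: \<psi>_def\<close>)
      then have "emeasure lborel (box (- One) (One :: real^'n)) = 0"
        by (subst (asm) AE_iff_measurable[OF _ refl]) (auto simp: )
      moreover have "emeasure lborel (box (- One) (One :: real^'n)) = (\<Prod>b\<in>(Basis :: (real^'n) set). (One - (- One)) \<bullet> b)"
        by (rule emeasure_lborel_box) (simp only: inner_minus_left inner_sum_left_Basis, simp)
      moreover have "(\<Prod>b\<in>(Basis :: (real^'n) set). (One - (- One)) \<bullet> b) = (\<Prod>b\<in>(Basis :: (real^'n) set). 2)"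
        by (rule prod.cong[OF refl]) (simp only: inner_diff_left inner_minus_left inner_sum_left_Basis, simp)
      ultimately show False by simp
    qed
    moreover have "B \<ge> 0" unfolding B_def using \<psi>_nonneg by simp
    ultimately show ?thesis by simp
  qed
  \<comment> \<open>Chosen so that \<epsilon> A / B = e A / (A + 1) \<le> e; the added 1 avoids
    having to show that \<open>A\<close> is positive.\<close>
  define \<epsilon> where "\<epsilon> = e * B / (A + 1)"
  have \<epsilon>: "\<epsilon> > 0" using e A B by (simp add: \<epsilon>_def)
  define E where "E y = indicator {0<..} y * exp (- (y / \<epsilon>))" for y
  have E: "integrable lborel E" "(LINT y|lborel. E y) = \<epsilon>"
    using has_bochner_integral_exp_decay[OF \<epsilon>] by (auto simp: E_def[abs_def] has_bochner_integral_iff)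
  have E_nonneg: "E y \<ge> 0" for y by (simp add: E_def)
  \<comment> \<open>The same formula is kept below the boundary, where it may grow: \<open>v\<close>
    is then differentiable everywhere, and integrability matters only in the half-space.\<close>
  define v :: "(real^'n) \<times> real \<Rightarrow> real" where "v z = \<psi> (fst z) * exp (- (snd z / \<epsilon>))" for z
  define g :: "(real^'n) \<times> real \<Rightarrow> (real^'n) \<times> real" where
    "g z = exp (- (snd z / \<epsilon>)) *\<^sub>R (D (fst z), - \<psi> (fst z) / \<epsilon>)" for z
  have v0: "zero_ext v = (\<lambda>z. E (snd z) *\<^sub>R \<psi> (fst z))"
    by (auto simp: zero_ext_def v_def E_def indicator_def mem_half_space_iff fun_eq_iff)
  have g0: "zero_ext g = (\<lambda>z. E (snd z) *\<^sub>R (D (fst z), - \<psi> (fst z) / \<epsilon>))"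
    by (auto simp: zero_ext_def g_def E_def indicator_def mem_half_space_iff fun_eq_iff)
  have v_int: "has_bochner_integral lborel (zero_ext v) (\<epsilon> * B)"
    using has_bochner_integral_product[OF \<psi>_int E(1)] by (simp add: v0 E(2) B_def)
  have g_int: "integrable lborel (zero_ext g)"
    using has_bochner_integral_product[OF integrable_Pair[of lborel D "\<lambda>x. - \<psi> x / \<epsilon>"] E(1)] D_int \<psi>_int
    by (simp add: g0 has_bochner_integral_iff)
  have wg: "L1_weak_gradient v g"
  proof (rule L1_weak_gradient_classical)
    fix z :: "(real^'n) \<times> real"
    have "((\<lambda>z. \<psi> (fst z)) has_derivative (\<lambda>h. D (fst z) \<bullet> fst h)) (at z)"
      unfolding D[symmetric]
      by (rule has_derivative_compose[OF _ test_function_has_derivative[OF \<psi>]]) (auto intro!: derivative_eq_intros)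
    moreover have "((\<lambda>z :: (real^'n) \<times> real. exp (- (snd z / \<epsilon>))) has_derivative
        (\<lambda>h. - (snd h / \<epsilon>) * exp (- (snd z / \<epsilon>)))) (at z)"
      using \<epsilon> by (auto intro!: derivative_eq_intros)
    ultimately show "(v has_derivative (\<lambda>h. \<psi> (fst z) * (- (snd h / \<epsilon>) * exp (- (snd z / \<epsilon>))) +
        (D (fst z) \<bullet> fst h) * exp (- (snd z / \<epsilon>)))) (at z)"
      unfolding v_def[abs_def] by (rule has_derivative_mult)
  next
    fix h :: "(real^'n) \<times> real"
    have "continuous_on UNIV (\<lambda>z :: (real^'n) \<times> real. D (fst z))" "continuous_on UNIV (\<lambda>z :: (real^'n) \<times> real. \<psi> (fst z))"
      by (auto intro!: continuous_on_compose2[OF D_cont] continuous_on_compose2[OF test_function_continuous[OF \<psi>]] continuous_intros)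
    then show "continuous_on UNIV (\<lambda>z. \<psi> (fst z) * (- (snd h / \<epsilon>) * exp (- (snd z / \<epsilon>))) +
        (D (fst z) \<bullet> fst h) * exp (- (snd z / \<epsilon>)))"
      by (intro continuous_intros) (use \<epsilon> in auto)
    show "g z \<bullet> h = \<psi> (fst z) * (- (snd h / \<epsilon>) * exp (- (snd z / \<epsilon>))) +
        (D (fst z) \<bullet> fst h) * exp (- (snd z / \<epsilon>))" for z
      by (simp add: g_def inner_prod_def algebra_simps)
  next
    show "set_integrable lborel half_space g" using g_int by (simp add: integrable_zero_ext_iff)
  qed
  have vW: "v \<in> W11"
    using v_int by (intro W11I[OF _ wg]) (simp add: has_bochner_integral_iff integrable_zero_ext_iff)
  have nonzero: "v \<in> W11_nonzero"
    unfolding W11_nonzero_def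
  proof (safe intro!: vW)
    assume "AE z in lborel. z \<in> half_space \<longrightarrow> v z = 0"
    then have "AE z in lborel. zero_ext v z = 0"
      by eventually_elim (auto simp: zero_ext_def indicator_def)
    then have "(LINT z|lborel. zero_ext v z) = 0" by (rule integral_eq_zero_AE)
    then show False using v_int \<epsilon> B by (simp add: has_bochner_integral_iff)
  qed
  have "has_trace v (\<lambda>x. v (x, 0))"
  proof (rule has_trace_continuous[OF vW])
    show "continuous_on closed_half_space v"
      unfolding v_def[abs_def]
      by (intro continuous_intros continuous_on_compose2[OF test_function_continuous[OF \<psi>]]) (use \<epsilon> in auto)
  qed (simp add: v_def \<psi>_int)
  \<comment> \<open>Uniqueness identifies the chosen trace with the restriction of \<open>v\<close>
    to height 0, which is \<psi>.\<close>
  then have tr: "AE x in lborel. boundary_trace v x = \<psi> x"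
    using has_trace_unique[OF vW has_trace_boundary_trace[OF vW]] by (simp add: v_def)
  have bt: "integrable lborel (boundary_trace v)"
    using has_trace_boundary_trace[OF vW] by (simp add: has_trace_def)
  have T: "(LINT x|lborel. \<bar>boundary_trace v x\<bar>) = B"
    unfolding B_def
  proof (rule integral_cong_AE)
    show "AE x in lborel. \<bar>boundary_trace v x\<bar> = \<psi> x"
      using tr by eventually_elim (simp add: \<psi>_nonneg)
  qed (use bt \<psi>_int in auto)
  have not0: "\<not> (AE x in lborel. boundary_trace v x = 0)"
  proof
    assume "AE x in lborel. boundary_trace v x = 0"
    then have "AE x in lborel. \<bar>boundary_trace v x\<bar> = 0" by eventually_elim simp
    then have "(LINT x|lborel. \<bar>boundary_trace v x\<bar>) = 0" by (rule integral_eq_zero_AE)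
    with T B show False by simp
  qed
  have "(LINT z:half_space|lborel. norm (weak_grad v z)) = (LINT z|lborel. norm (zero_ext g z))"
    unfolding set_lebesgue_integral_def
  proof (rule integral_cong_AE)
    show "(\<lambda>z. indicator half_space z *\<^sub>R norm (weak_grad v z)) \<in> borel_measurable lborel"
      using integrable_norm[OF W11_zero_ext_integrable(2)[OF vW]] borel_measurable_integrable
      by (force simp: zero_ext_def)
    show "AE z in lborel. indicator half_space z *\<^sub>R norm (weak_grad v z) = norm (zero_ext g z)"
      using weak_grad_AE[OF wg] by eventually_elim (auto simp: zero_ext_def indicator_def)
  qed (use g_int in auto)
  also have "\<dots> \<le> (LINT z|lborel. E (snd z) *\<^sub>R (norm (D (fst z)) + \<psi> (fst z) / \<epsilon>))"
  proof (rule integral_mono)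
    show "integrable lborel (\<lambda>z. E (snd z) *\<^sub>R (norm (D (fst z)) + \<psi> (fst z) / \<epsilon>))"
      using has_bochner_integral_product[OF _ E(1), of "\<lambda>x. norm (D x) + \<psi> x / \<epsilon>"] D_int \<psi>_int
      by (simp add: has_bochner_integral_iff)
    fix z :: "(real^'n) \<times> real"
    have "norm (D (fst z), - \<psi> (fst z) / \<epsilon>) \<le> norm (D (fst z)) + \<psi> (fst z) / \<epsilon>"
      using norm_Pair_le[of "D (fst z)" "- \<psi> (fst z) / \<epsilon>"] \<epsilon> \<psi>_nonneg[of "fst z"] by simp
    then show "norm (zero_ext g z) \<le> E (snd z) *\<^sub>R (norm (D (fst z)) + \<psi> (fst z) / \<epsilon>)"
      unfolding g0 norm_scaleR using E_nonneg[of "snd z"] by (simp add: mult_left_mono)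
  qed (use g_int in simp)
  also have "\<dots> = \<epsilon> * (LINT x|lborel. norm (D x) + \<psi> x / \<epsilon>)"
    using has_bochner_integral_product[OF _ E(1), of "\<lambda>x. norm (D x) + \<psi> x / \<epsilon>"] D_int \<psi>_int
    by (simp add: has_bochner_integral_iff E(2))
  also have "\<dots> = \<epsilon> * A + B"
    using D_int \<psi>_int \<epsilon> by (simp add: A_def B_def distrib_left)
  finally have "(LINT z:half_space|lborel. norm (weak_grad v z)) / B \<le> (\<epsilon> * A + B) / B"
    using B by (intro divide_right_mono) auto
  also have "\<epsilon> * A = B * (e * (A / (A + 1)))" by (simp add: \<epsilon>_def)
  also have "(B * (e * (A / (A + 1))) + B) / B = 1 + e * (A / (A + 1))"
    using B by (simp add: add_divide_distrib)
  also have "\<dots> \<le> 1 + e"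
    using mult_left_mono[of "A / (A + 1)" 1 e] e A by simp
  finally have "J v \<le> ereal (1 + e)" using not0 T by (simp add: J_def)
  with nonzero show ?thesis by blast
qed

section \<open>Extremal functions\<close>

text \<open>Increments along a horizontal unit vector vanish, so the mass of \<open>u\<close> in a
  strip |z \<bullet> d| \<le> R equals the mass in translates of that strip arbitrarily far away.
  For an integrable function this is 0.\<close>

lemma horizontally_constant_imp_AE_zero:
  fixes u :: "(real^'n) \<times> real \<Rightarrow> real"
  assumes u: "u \<in> W11" and fst0: "AE z in lborel. fst (zero_ext (weak_grad u) z) = 0"
  shows "AE z in lborel. zero_ext u z = 0"
proof -
  \<comment> \<open>The index type is nonempty, so \<open>undefined\<close> denotes one of its
    coordinates; a single horizontal direction suffices.\<close>
  define d :: "(real^'n) \<times> real" where "d = (axis undefined 1, 0)"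
  have d: "d \<in> Basis" "snd d = 0" by (auto simp: d_def Basis_prod_def axis_in_Basis_iff)
  have dd: "d \<bullet> d = 1" using d(1) by simp
  \<comment> \<open>A representative whose horizontal part is exactly 0. Its line integrals in
    direction \<open>d\<close> vanish on every line, with no need to see how a null set meets
    segments.\<close>
  define h :: "(real^'n) \<times> real \<Rightarrow> (real^'n) \<times> real" where "h z = (0, snd (zero_ext (weak_grad u) z))" for z
  note u0 = W11_zero_ext_integrable(1)[OF u] and g0 = W11_zero_ext_integrable(2)[OF u]
  have h: "integrable lborel h" unfolding h_def[abs_def] by (intro integrable_Pair) (use g0 in auto)
  have wg: "L1_weak_gradient (zero_ext u) h"
  proof (rule L1_weak_gradientI)
    show "set_integrable lborel half_space h" by (rule integrable_imp_set_integrable_half_space[OF h])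
    fix \<phi> :: "(real^'n) \<times> real \<Rightarrow> real" and e :: "(real^'n) \<times> real"
    assume \<phi>: "test_function half_space \<phi>" and e: "e \<in> Basis"
    have "(LINT z|lborel. (zero_ext (weak_grad u) z \<bullet> e) * \<phi> z) = (LINT z|lborel. (h z \<bullet> e) * \<phi> z)"
    proof (rule integral_cong_AE)
      show "AE z in lborel. (zero_ext (weak_grad u) z \<bullet> e) * \<phi> z = (h z \<bullet> e) * \<phi> z"
        using fst0 by eventually_elim (simp add: h_def inner_prod_def)
      show "(\<lambda>z. (zero_ext (weak_grad u) z \<bullet> e) * \<phi> z) \<in> borel_measurable lborel"
        "(\<lambda>z. (h z \<bullet> e) * \<phi> z) \<in> borel_measurable lborel"
        using g0 h by (intro borel_measurable_integrable integrable_mult_test_function(1)[OF _ \<phi>]; simp)+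
    qed
    with L1_weak_gradientD(2)[OF W11_weak_grad[OF u] \<phi> e]
    show "(LINT z|lborel. zero_ext u z * frechet_derivative \<phi> (at z) e) = - (LINT z|lborel. (h z \<bullet> e) * \<phi> z)"
      by simp
  qed
  have inc: "AE z in lborel. zero_ext u (z + real k *\<^sub>R d) = zero_ext u z" for k
  proof -
    have "AE z in lborel. z \<in> half_space \<longrightarrow> zero_ext u (z + real k *\<^sub>R d) - zero_ext u z =
        translates (\<lambda>s. s *\<^sub>R d) (indicator {0..real k}) (\<lambda>z. zero_ext h z \<bullet> d) z"
      by (rule W11_increment[OF integrable_imp_set_integrable_half_space[OF u0] wg d(1)]) (simp_all add: d)
    then show ?thesis
    proof eventually_elim
      case (elim z)
      have "zero_ext h w \<bullet> d = 0" for w by (simp add: zero_ext_def h_def inner_prod_def d(2))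
      then have "translates (\<lambda>s. s *\<^sub>R d) (indicator {0..real k}) (\<lambda>z. zero_ext h z \<bullet> d) z = 0"
        by (simp add: translates_def)
      \<comment> \<open>A horizontal shift preserves both the half-space and its complement, so the
        invariance holds for the extension by zero on the whole space.\<close>
      moreover have "z + real k *\<^sub>R d \<in> half_space \<longleftrightarrow> z \<in> half_space" by (simp add: mem_half_space_iff d(2))
      ultimately show ?case using elim by (cases "z \<in> half_space") auto
    qed
  qed
  have "AE z in lborel. \<bar>z \<bullet> d\<bar> \<le> real R \<longrightarrow> zero_ext u z = 0" for R :: nat
  proof -
    let ?S = "{z. \<bar>z \<bullet> d\<bar> \<le> real R}"
    have S [measurable]: "?S \<in> sets borel"
      by (intro borel_closed closed_Collect_le continuous_intros)
    have esc: "\<forall>\<^sub>F k in sequentially. z - real k *\<^sub>R d \<notin> ?S" for z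
    proof -
      obtain m where m: "z \<bullet> d + real R < real m" using reals_Archimedean2 by blast
      show ?thesis
        by (rule eventually_mono[OF eventually_ge_at_top[of m]]) (use m in \<open>auto simp: inner_diff_left dd\<close>)
    qed
    have i: "integrable lborel (\<lambda>z. \<bar>zero_ext u z\<bar> * indicator ?S z)"
      by (rule integrable_mult_bounded[OF _ borel_measurable_indicator, where B = 1])
         (use u0 S in \<open>auto split: split_indicator\<close>)
    have "(LINT z|lborel. \<bar>zero_ext u (z + real k *\<^sub>R d)\<bar> * indicator ?S z) = (LINT z|lborel. \<bar>zero_ext u z\<bar> * indicator ?S z)" for k
    proof (rule integral_cong_AE)
      note [measurable] = borel_measurable_integrable[OF u0]
      show "(\<lambda>z. \<bar>zero_ext u (z + real k *\<^sub>R d)\<bar> * indicator ?S z) \<in> borel_measurable lborel" by measurable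
      show "AE z in lborel. \<bar>zero_ext u (z + real k *\<^sub>R d)\<bar> * indicator ?S z = \<bar>zero_ext u z\<bar> * indicator ?S z"
        using inc[of k] by eventually_elim simp
    qed (use i in auto)
    then have "(LINT z|lborel. \<bar>zero_ext u z\<bar> * indicator ?S z) = 0"
      using integral_escaping_set_tendsto_0[OF u0 S esc] by (simp add: LIMSEQ_const_iff)
    then have "AE z in lborel. \<bar>zero_ext u z\<bar> * indicator ?S z = 0"
      using integral_nonneg_eq_0_iff_AE[OF i] by simp
    then show ?thesis by eventually_elim (auto simp: indicator_def)
  qed
  then have "AE z in lborel. \<forall>R::nat. \<bar>z \<bullet> d\<bar> \<le> real R \<longrightarrow> zero_ext u z = 0"
    by (subst AE_all_countable) simp
  then show ?thesis
    by (rule eventually_mono) (use real_arch_simple in blast)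
qed

theorem mainTheorem4:
  shows "\<not> (\<exists>u :: (real^'n) \<times> real \<Rightarrow> real.
           u \<in> W11_nonzero \<and> J u = (INF v \<in> (W11_nonzero :: ((real^'n) \<times> real \<Rightarrow> real) set). J v))"
proof
  assume "\<exists>u :: (real^'n) \<times> real \<Rightarrow> real.
    u \<in> W11_nonzero \<and> J u = (INF v \<in> (W11_nonzero :: ((real^'n) \<times> real \<Rightarrow> real) set). J v)"
  then obtain u :: "(real^'n) \<times> real \<Rightarrow> real" where un: "u \<in> W11_nonzero"
    and Ju: "J u = (INF v \<in> (W11_nonzero :: ((real^'n) \<times> real \<Rightarrow> real) set). J v)" by blast
  have u: "u \<in> W11" using un by (simp add: W11_nonzero_def)
  let ?g = "zero_ext (weak_grad u)" and ?f = "boundary_trace u"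
  have "J u \<le> 1 + ereal e" if e: "e > 0" for e
  proof -
    obtain v where "v \<in> (W11_nonzero :: ((real^'n) \<times> real \<Rightarrow> real) set)" "J v \<le> ereal (1 + e)"
      using W11_nonzero_J_near_1[OF e] by blast
    moreover from this have "J u \<le> J v" unfolding Ju by (intro INF_lower)
    ultimately show ?thesis by (simp add: order_trans)
  qed
  then have J1: "J u \<le> 1" by (rule ereal_le_epsilon2)
  \<comment> \<open>A vanishing trace would give \<open>J u = \<infinity>\<close>. The quotient
    therefore has a nonzero denominator and is not the conventional value of a division by
    0.\<close>
  then have not0: "\<not> (AE x in lborel. ?f x = 0)" by (auto simp: J_def)
  with J1 have le1: "(LINT z:half_space|lborel. norm (weak_grad u z)) / (LINT x|lborel. \<bar>?f x\<bar>) \<le> 1"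
    by (simp add: J_def)
  have f: "integrable lborel ?f" using has_trace_boundary_trace[OF u] by (simp add: has_trace_def)
  have "(LINT x|lborel. \<bar>?f x\<bar>) \<noteq> 0"
    using integral_nonneg_eq_0_iff_AE[of lborel "\<lambda>x. \<bar>?f x\<bar>"] f not0 by simp
  moreover have "(LINT x|lborel. \<bar>?f x\<bar>) \<ge> 0" by simp
  ultimately have "0 < (LINT x|lborel. \<bar>?f x\<bar>)" by linarith
  with le1 have "(LINT z:half_space|lborel. norm (weak_grad u z)) \<le> (LINT x|lborel. \<bar>?f x\<bar>)"
    by (simp add: divide_le_eq)
  \<comment> \<open>This closes the chain: the full gradient has no larger integral than its
    vertical component, although it dominates it pointwise.\<close>
  also have "\<dots> \<le> (LINT z|lborel. \<bar>snd (?g z)\<bar>)"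
    by (rule integral_trace_le[OF u has_trace_boundary_trace[OF u]])
  also have "(LINT z:half_space|lborel. norm (weak_grad u z)) = (LINT z|lborel. norm (?g z))"
    by (simp add: set_lebesgue_integral_def zero_ext_def)
  finally have le: "(LINT z|lborel. norm (?g z)) \<le> (LINT z|lborel. \<bar>snd (?g z)\<bar>)" .
  note g0 = W11_zero_ext_integrable(2)[OF u]
  have snd_le: "\<bar>snd (?g z)\<bar> \<le> norm (?g z)" for z
    using norm_snd_le[of "snd (?g z)" "fst (?g z)"] by simp
  have i: "integrable lborel (\<lambda>z. norm (?g z) - \<bar>snd (?g z)\<bar>)" using g0 by simp
  have "(LINT z|lborel. norm (?g z) - \<bar>snd (?g z)\<bar>) \<ge> 0"
    by (intro integral_nonneg_AE) (simp add: snd_le)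
  with le g0 have "(LINT z|lborel. norm (?g z) - \<bar>snd (?g z)\<bar>) = 0" by simp
  then have "AE z in lborel. norm (?g z) - \<bar>snd (?g z)\<bar> = 0"
    using integral_nonneg_eq_0_iff_AE[OF i] snd_le by simp
  then have "AE z in lborel. fst (?g z) = 0"
  proof eventually_elim
    case (elim z)
    \<comment> \<open>Pythagoras for the product norm: a vector as long as its vertical component
      has no horizontal component.\<close>
    then have "(norm (?g z))\<^sup>2 = (snd (?g z))\<^sup>2" by (simp add: power2_eq_iff)
    moreover have "(norm (?g z))\<^sup>2 = (norm (fst (?g z)))\<^sup>2 + (snd (?g z))\<^sup>2"
      by (simp add: norm_prod_def)
    ultimately show ?case by simp
  qed
  from horizontally_constant_imp_AE_zero[OF u this]
  have "AE z in lborel. z \<in> half_space \<longrightarrow> u z = 0"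
    by eventually_elim (metis zero_ext_eq)
  with un show False by (simp add: W11_nonzero_def)
qed

end
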